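(* Let $f:(\mathbb{K}^n,S)\to(\mathbb{K}^p,0)$ be an analytic multigerm with finite multiplicity and of corank at most one. (1) Let $F:(\mathbb{K}^n\times\mathbb{K}^r,S\times\{0\})\to(\mathbb{K}^p\times\mathbb{K}^r,(0,0))$, $F(x,\lambda)=(f_\lambda(x),\lambda)$ with $f_0=f$, be a stable unfolding of $f$. For $1\le i\le r$ let $g_i:(\mathbb{K}^p\times\mathbb{K}^r,(0,0))\to(\mathbb{K}^p\times\mathbb{K}^r,(0,0))$ be $g_i(X_1,\dots,X_p,\lambda_1,\dots,\lambda_r)=(X_1,\dots,X_p,\lambda_1,\dots,\lambda_{i-1},\lambda_i^2,\lambda_{i+1},\dots,\lambda_r)$. Let $\eta=(\eta_1,\dots,\eta_p,\eta_{p+1},\dots,\eta_{p+r})$ be a vector field germ at $(0,0)$ which is liftable over $F$ and liftable over every $g_i$ $(1\le i\le r)$. Then $\overline{\eta}(X)=(\eta_1(X,0),\dots,\eta_p(X,0))$ belongs to $Lift(f)$. (2) Suppose $f$ admits a one-parameter stable unfolding $F:(\mathbb{K}^n\times\mathbb{K},S\times\{0\})\to(\mathbb{K}^p\times\mathbb{K},(0,0))$, $F(x,\lambda)=(f_\lambda(x),\lambda)$, $f_0=f$. Then for any $\overline{\eta}\in Lift(f)$ there exists $\eta=(\eta_1,\dots,\eta_p,\eta_{p+1})$ liftable over both $F$ and $g_1$ (where $g_1(X,\lambda)=(X,\lambda^2)$) such that $\overline{\eta}(X)=(\eta_1(X,0),\dots,\eta_p(X,0))$.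
   Context: $\mathbb{K}=\mathbb{R}$ or $\mathbb{C}$; analytic = real-analytic or holomorphic accordingly. $S\subset\mathbb{K}^n$ finite. For an analytic multigerm $h:(\mathbb{K}^a,S')\to(\mathbb{K}^b,0)$: $C_{S'}$ is the ring of analytic function germs at $S'$, $C_0$ those at $0\in\mathbb{K}^b$, $m_0$ its maximal ideal, $\theta_{S'}(h)$ the module of analytic vector fields along $h$, $\theta_{S'}(a)$ vector fields on $(\mathbb{K}^a,S')$, $\theta_0(b)$ vector fields on $(\mathbb{K}^b,0)$. $T\mathcal{R}_e(h)=\{dh\circ\xi:\xi\in\theta_{S'}(a)\}$, $T\mathcal{A}_e(h)=T\mathcal{R}_e(h)+\{\eta\circ h:\eta\in\theta_0(b)\}$. $\eta\in\theta_0(b)$ is liftable over $h$ if $\eta\circ h\in T\mathcal{R}_e(h)$; $Lift(h)$ is the $C_0$-module of such. $h$ is stable if $\theta_{S'}(h)=T\mathcal{A}_e(h)$. $f$ has finite multiplicity if $Q(f)=C_S/f^*m_0C_S$ is finite-dimensional over $\mathbb{K}$ (then $n\le p$). $f$ is of corank at most one if $n-\mathrm{rank}\,Jf(s)\le1$ for all $s\in S$. *)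

theory Defs
  imports "HOL-Analysis.Analysis"
begin

text \<open>K is a type 'k of class real_normed_field (by Mazur's theorem: R or C).
Points of K^a are vectors 'k^'a indexed by a finite type 'a.  Germs at a finite
set A are represented by total functions; properties of germs are required on
some open neighbourhood of A.\<close>

definition monom :: "('a::finite \<Rightarrow> nat) \<Rightarrow> 'k::real_normed_field ^ 'a \<Rightarrow> 'k" where
  "monom \<alpha> x = (\<Prod>i\<in>UNIV. (x $ i) ^ (\<alpha> i))"

definition analytic_pt :: "('k::real_normed_field ^ 'a::finite \<Rightarrow> 'k) \<Rightarrow> 'k ^ 'a \<Rightarrow> bool" where
  "analytic_pt \<phi> a \<longleftrightarrow> (\<exists>r>0. \<exists>c :: ('a \<Rightarrow> nat) \<Rightarrow> 'k. \<forall>x\<in>ball a r.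
      (\<lambda>\<alpha>. norm (c \<alpha> * monom \<alpha> (x - a))) summable_on UNIV \<and>
      ((\<lambda>\<alpha>. c \<alpha> * monom \<alpha> (x - a)) has_sum \<phi> x) UNIV)"

definition near :: "('a::topological_space) set \<Rightarrow> ('a \<Rightarrow> bool) \<Rightarrow> bool" where
  "near A P \<longleftrightarrow> (\<exists>U. open U \<and> A \<subseteq> U \<and> (\<forall>x\<in>U. P x))"

definition agree_near :: "('a::topological_space) set \<Rightarrow> ('a \<Rightarrow> 'b) \<Rightarrow> ('a \<Rightarrow> 'b) \<Rightarrow> bool" where
  "agree_near A g h \<longleftrightarrow> near A (\<lambda>x. g x = h x)"

definition an_fun :: "('k::real_normed_field ^ 'a::finite) set \<Rightarrow> ('k ^ 'a \<Rightarrow> 'k) \<Rightarrow> bool" where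
  "an_fun A \<phi> \<longleftrightarrow> near A (analytic_pt \<phi>)"

definition an_map :: "('k::real_normed_field ^ 'a::finite) set \<Rightarrow> ('k ^ 'a \<Rightarrow> 'k ^ 'b::finite) \<Rightarrow> bool" where
  "an_map A \<phi> \<longleftrightarrow> near A (\<lambda>x. \<forall>j. analytic_pt (\<lambda>y. \<phi> y $ j) x)"

definition multigerm :: "('k::real_normed_field ^ 'a::finite) set \<Rightarrow> ('k ^ 'a \<Rightarrow> 'k ^ 'b::finite) \<Rightarrow> bool" where
  "multigerm A h \<longleftrightarrow> finite A \<and> an_map A h \<and> (\<forall>s\<in>A. h s = 0)"

definition dcomp :: "('k::real_normed_field ^ 'a::finite \<Rightarrow> 'k ^ 'b::finite) \<Rightarrow> ('k ^ 'a \<Rightarrow> 'k ^ 'a) \<Rightarrow> 'k ^ 'a \<Rightarrow> 'k ^ 'b" where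
  "dcomp h \<xi> x = frechet_derivative h (at x) (\<xi> x)"

definition in_TRe :: "('k::real_normed_field ^ 'a::finite \<Rightarrow> 'k ^ 'b::finite) \<Rightarrow> ('k ^ 'a) set \<Rightarrow> ('k ^ 'a \<Rightarrow> 'k ^ 'b) \<Rightarrow> bool" where
  "in_TRe h A \<psi> \<longleftrightarrow> (\<exists>\<xi>. an_map A \<xi> \<and> agree_near A \<psi> (dcomp h \<xi>))"

definition liftable :: "('k::real_normed_field ^ 'a::finite \<Rightarrow> 'k ^ 'b::finite) \<Rightarrow> ('k ^ 'a) set \<Rightarrow> ('k ^ 'b \<Rightarrow> 'k ^ 'b) \<Rightarrow> bool" where
  "liftable h A \<eta> \<longleftrightarrow> an_map {0} \<eta> \<and> in_TRe h A (\<eta> \<circ> h)"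

definition stable :: "('k::real_normed_field ^ 'a::finite \<Rightarrow> 'k ^ 'b::finite) \<Rightarrow> ('k ^ 'a) set \<Rightarrow> bool" where
  "stable h A \<longleftrightarrow> (\<forall>\<psi>. an_map A \<psi> \<longrightarrow>
     (\<exists>\<xi> \<eta>. an_map A \<xi> \<and> an_map {0} \<eta> \<and>
        agree_near A \<psi> (\<lambda>x. dcomp h \<xi> x + \<eta> (h x))))"

text \<open>Finite multiplicity: Q(f) = C_S / f^*m_0 C_S is finite dimensional over K, i.e.
finitely many germs span C_S modulo the ideal generated by {u \<circ> f : u \<in> m_0}.\<close>
definition finite_multiplicity :: "('k::real_normed_field ^ 'n::finite \<Rightarrow> 'k ^ 'p::finite) \<Rightarrow> ('k ^ 'n) set \<Rightarrow> bool" where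
  "finite_multiplicity f S \<longleftrightarrow> (\<exists>B. finite B \<and> (\<forall>b\<in>B. an_fun S b) \<and>
     (\<forall>g. an_fun S g \<longrightarrow> (\<exists>(c :: ('k ^ 'n \<Rightarrow> 'k) \<Rightarrow> 'k) (m::nat) a u.
        (\<forall>k<m. an_fun S (a k) \<and> an_fun {0} (u k) \<and> u k 0 = 0) \<and>
        agree_near S g (\<lambda>x. (\<Sum>b\<in>B. c b * b x) + (\<Sum>k<m. a k x * u k (f x))))))"

definition jac :: "('k::real_normed_field ^ 'n::finite \<Rightarrow> 'k ^ 'p::finite) \<Rightarrow> 'k ^ 'n \<Rightarrow> 'k ^ 'n ^ 'p" where
  "jac f x = (\<chi> i j. frechet_derivative f (at x) (axis j 1) $ i)"

definition corank_le_one :: "('k::real_normed_field ^ 'n::finite \<Rightarrow> 'k ^ 'p::finite) \<Rightarrow> ('k ^ 'n) set \<Rightarrow> bool" where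
  "corank_le_one f S \<longleftrightarrow> (\<forall>s\<in>S. CARD('n) - rank (jac f s) \<le> 1)"

definition pt :: "'k ^ 'n::finite \<Rightarrow> 'k ^ 'r::finite \<Rightarrow> 'k ^ ('n + 'r)" where
  "pt x l = (\<chi> k. case k of Inl i \<Rightarrow> x $ i | Inr j \<Rightarrow> l $ j)"

definition unfolding_of :: "('k::real_normed_field ^ 'n::finite \<Rightarrow> 'k ^ 'p::finite) \<Rightarrow> ('k ^ 'n) set
     \<Rightarrow> ('k ^ ('n + 'r::finite) \<Rightarrow> 'k ^ ('p + 'r)) \<Rightarrow> bool" where
  "unfolding_of f S F \<longleftrightarrow>
     multigerm ((\<lambda>s. pt s 0) ` S) F \<and>
     near ((\<lambda>s. pt s 0) ` S) (\<lambda>y. \<forall>j. F y $ Inr j = y $ Inr j) \<and>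
     agree_near S (\<lambda>x. \<chi> i. F (pt x 0) $ Inl i) f"

definition gsq :: "'r \<Rightarrow> 'k::real_normed_field ^ ('p::finite + 'r::finite) \<Rightarrow> 'k ^ ('p + 'r)" where
  "gsq i y = (\<chi> k. case k of Inl _ \<Rightarrow> y $ k | Inr j \<Rightarrow> (if j = i then (y $ k)^2 else y $ k))"

definition restr :: "('k::real_normed_field ^ ('p::finite + 'r::finite) \<Rightarrow> 'k ^ ('p + 'r)) \<Rightarrow> 'k ^ 'p \<Rightarrow> 'k ^ 'p" where
  "restr \<eta> X = (\<chi> i. \<eta> (pt X 0) $ Inl i)"

end

theory Submission
  imports "HOL-Computational_Algebra.Fundamental_Theorem_Algebra" Defs
begin

text \<open>Restricting to \<open>\<lambda> = 0\<close> gives the first part: liftability over \<open>g\<^sub>i\<close> forces the \<open>\<lambda>\<^sub>i\<close>-component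
  of \<open>\<eta>\<close> to vanish on \<open>\<lambda>\<^sub>i = 0\<close>, so the lift of \<open>\<eta>\<close> over \<open>F\<close> is tangent to \<open>\<lambda> = 0\<close> there and
  restricts to a lift over \<open>f\<close>.

  For the second part let \<open>\<eta>\<^sub>0\<close>, \<open>\<xi>\<^sub>0\<close> be the constant extensions in \<open>\<lambda>\<close> of the given field and of
  its lift. Then \<open>\<eta>\<^sub>0 \<circ> F - dF \<circ> \<xi>\<^sub>0\<close> vanishes on \<open>\<lambda> = 0\<close>, hence equals \<open>\<lambda>\<psi>\<close> with \<open>\<psi>\<close> analytic, and
  stability gives \<open>\<psi> = dF \<circ> \<xi>\<^sub>1 + \<eta>\<^sub>1 \<circ> F\<close>. As \<open>F\<close> preserves \<open>\<lambda>\<close>, the field \<open>\<eta> = \<eta>\<^sub>0 - \<lambda>\<eta>\<^sub>1\<close> lifts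
  to \<open>\<xi>\<^sub>0 + \<lambda>\<xi>\<^sub>1\<close>; its last component is divisible by \<open>\<lambda>\<close>, which is liftability over \<open>g\<^sub>1\<close>.

  Composition of analytic maps needs infinite sums to exist in the field; their existence
  follows from Ostrowski's theorem that the field is the real or the complex numbers.\<close>

subsection \<open>Absolute convergence in real normed fields\<close>

definition poly_Re :: "complex poly \<Rightarrow> 'k::real_normed_field \<Rightarrow> 'k" where
  "poly_Re p x = poly (map_poly (\<lambda>z. of_real (Re z)) p) x"

definition poly_Im :: "complex poly \<Rightarrow> 'k::real_normed_field \<Rightarrow> 'k" where
  "poly_Im p x = poly (map_poly (\<lambda>z. of_real (Im z)) p) x"

text \<open>The field may lack a square root of -1, so p(x) exists only as the formal pair
  \<open>poly_Re\<close>, \<open>poly_Im\<close>. This is p(x) times its conjugate, a genuine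
  element of \<open>'k\<close>.\<close>

definition poly_norm :: "complex poly \<Rightarrow> 'k::real_normed_field \<Rightarrow> 'k" where
  "poly_norm p x = (poly_Re p x)\<^sup>2 + (poly_Im p x)\<^sup>2"

lemma poly_Re_pCons [simp]: "poly_Re (pCons a p) x = of_real (Re a) + x * poly_Re p x"
  and poly_Im_pCons [simp]: "poly_Im (pCons a p) x = of_real (Im a) + x * poly_Im p x"
  and poly_Re_0 [simp]: "poly_Re 0 x = 0" and poly_Im_0 [simp]: "poly_Im 0 x = 0"
  by (simp_all add: poly_Re_def poly_Im_def map_poly_pCons)

lemma
  fixes x :: "'k::real_normed_field"
  shows poly_Re_add: "poly_Re (p + q) x = poly_Re p x + poly_Re q x"
    and poly_Im_add: "poly_Im (p + q) x = poly_Im p x + poly_Im q x"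
proof -
  have "map_poly (\<lambda>z. of_real (Re z) :: 'k) (p + q)
      = map_poly (\<lambda>z. of_real (Re z)) p + map_poly (\<lambda>z. of_real (Re z)) q"
    "map_poly (\<lambda>z. of_real (Im z) :: 'k) (p + q)
      = map_poly (\<lambda>z. of_real (Im z)) p + map_poly (\<lambda>z. of_real (Im z)) q"
    by (rule poly_eqI; simp add: coeff_map_poly)+
  then show "poly_Re (p + q) x = poly_Re p x + poly_Re q x"
    "poly_Im (p + q) x = poly_Im p x + poly_Im q x"
    by (simp_all add: poly_Re_def poly_Im_def)
qed

lemma
  poly_Re_smult: "poly_Re (smult c p) x = of_real (Re c) * poly_Re p x - of_real (Im c) * poly_Im p x" (is ?R)
  and poly_Im_smult: "poly_Im (smult c p) x = of_real (Re c) * poly_Im p x + of_real (Im c) * poly_Re p x" (is ?I)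
proof -
  have "?R \<and> ?I"
  proof (induction p)
    case (pCons a p)
    then show ?case by (simp add: pCons.IH distrib_left right_diff_distrib mult_ac)
  qed simp
  then show ?R ?I by blast+
qed

lemma
  poly_Re_mult: "poly_Re (p * q) x = poly_Re p x * poly_Re q x - poly_Im p x * poly_Im q x" (is ?R)
  and poly_Im_mult: "poly_Im (p * q) x = poly_Re p x * poly_Im q x + poly_Im p x * poly_Re q x" (is ?I)
proof -
  have "?R \<and> ?I"
  proof (induction p)
    case (pCons a p)
    have "poly_Re (pCons a p * q) x = poly_Re (pCons a p) x * poly_Re q x - poly_Im (pCons a p) x * poly_Im q x"
      "poly_Im (pCons a p * q) x = poly_Re (pCons a p) x * poly_Im q x + poly_Im (pCons a p) x * poly_Re q x"
      by (simp_all only: mult_pCons_left poly_Re_add poly_Im_add poly_Re_smult poly_Im_smult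
            poly_Re_pCons poly_Im_pCons pCons.IH) (simp_all add: algebra_simps)
    then show ?case by blast
  qed simp
  then show ?R ?I by blast+
qed

lemma poly_norm_mult: "poly_norm (p * q) x = poly_norm p x * poly_norm q x"
  by (simp add: poly_norm_def poly_Re_mult poly_Im_mult power2_eq_square algebra_simps)

lemma poly_power_real:
  assumes "poly_Im p x = 0"
  shows "poly_Re (p ^ n) x = poly_Re p x ^ n \<and> poly_Im (p ^ n) x = 0"
proof (induction n)
  case 0
  have "poly_Re [:1:] x = 1" "poly_Im [:1:] x = 0" by (simp_all only: poly_Re_pCons poly_Im_pCons) auto
  then show ?case by (simp add: one_pCons)
qed (simp add: poly_Re_mult poly_Im_mult assms)

text \<open>The norm of x^2 - 2 Re(z) x + |z|^2, the value at x of the real quadratic with roots z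
  and \<open>cnj z\<close>.\<close>

definition quad_norm :: "'k::real_normed_field \<Rightarrow> complex \<Rightarrow> real" where
  "quad_norm x z = norm ((x - of_real (Re z))\<^sup>2 + (of_real (Im z))\<^sup>2)"

lemma quad_norm_linear: "norm (poly_norm [:-z, 1:] x) = quad_norm x z"
  by (simp add: poly_norm_def quad_norm_def)

text \<open>The fundamental theorem of algebra splits off a linear factor, on which the
  multiplicative \<open>poly_norm\<close> has norm \<open>quad_norm x z\<close>, at least m. As p is
  monic, the induction on the degree ends at the constant 1.\<close>

lemma quad_norm_poly_lower_bound:
  fixes x :: "'k::real_normed_field"
  assumes m: "\<And>z. m \<le> quad_norm x z" "0 \<le> m" and p: "lead_coeff p = 1"
  shows "m ^ degree p \<le> norm (poly_norm p x)"
  using p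
proof (induction "degree p" arbitrary: p)
  case 0
  then obtain a where "p = [:a:]" by (metis degree_eq_zeroE)
  with 0 have "p = [:1:]" by simp
  then show ?case by (simp add: poly_norm_def)
next
  case (Suc n)
  then have "\<not> constant (poly p)" by (simp add: constant_degree)
  then obtain z where "poly p z = 0" using fundamental_theorem_of_algebra by blast
  then obtain q where q: "p = [:-z, 1:] * q" by (metis dvdE poly_eq_0_iff_dvd)
  have q0: "q \<noteq> 0" using q Suc.prems by auto
  then have d: "degree p = Suc (degree q)" by (simp add: q degree_mult_eq del: mult_pCons_left)
  have "lead_coeff q = 1" using Suc.prems by (simp add: q lead_coeff_mult del: mult_pCons_left)
  with Suc d have "m ^ degree q \<le> norm (poly_norm q x)" by simp
  then have "m * m ^ degree q \<le> quad_norm x z * norm (poly_norm q x)"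
    using m by (intro mult_mono) (auto intro: order_trans[OF m(2)])
  then show ?case
    by (simp only: q poly_norm_mult norm_mult quad_norm_linear d[unfolded q] power_Suc)
qed

text \<open>Outside a disc the values exceed the one at 0, so the infimum is attained on a compact
  disc. The minimisers form a compact set, hence one of them has largest modulus.\<close>

lemma quad_norm_attains_inf:
  fixes x :: "'k::real_normed_field"
  obtains z where "\<And>w. quad_norm x z \<le> quad_norm x w"
    "\<And>w. quad_norm x w = quad_norm x z \<Longrightarrow> norm w \<le> norm z"
proof -
  \<comment> \<open>For |w| = 3|x| + t with t > 1, the lower bound |w|^2 - 2|w||x| - |x|^2 equals
    2|x|^2 + 4|x|t + t^2, which exceeds the value |x|^2 at 0.\<close>
  define R where "R = 3 * norm x + 1"
  have cont: "continuous_on A (quad_norm x)" for A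
    unfolding quad_norm_def by (intro continuous_intros)
  have big: "quad_norm x 0 < quad_norm x w" if "R < norm w" for w
  proof -
    have e: "(x - of_real (Re w))\<^sup>2 + (of_real (Im w))\<^sup>2
        = of_real ((norm w)\<^sup>2) - (of_real (2 * Re w) * x - x\<^sup>2)"
      by (simp only: cmod_power2) (simp add: power2_eq_square algebra_simps)
    have "norm (of_real (2 * Re w) * x - x\<^sup>2) \<le> norm (of_real (2 * Re w) * x) + norm (x\<^sup>2)"
      by (rule norm_triangle_ineq4)
    also have "\<dots> \<le> 2 * norm w * norm x + (norm x)\<^sup>2"
      using abs_Re_le_cmod[of w] by (simp add: norm_mult norm_power mult_right_mono)
    finally have "(norm w)\<^sup>2 - (2 * norm w * norm x + (norm x)\<^sup>2) \<le> quad_norm x w"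
      unfolding quad_norm_def e
      using norm_triangle_ineq2[of "of_real ((norm w)\<^sup>2)" "of_real (2 * Re w) * x - x\<^sup>2"]
      by (simp add: norm_power)
    moreover have "(norm x)\<^sup>2 < (norm w)\<^sup>2 - (2 * norm w * norm x + (norm x)\<^sup>2)"
    proof -
      define t where "t = norm w - 3 * norm x"
      have "t > 1" "norm w = 3 * norm x + t" using that by (auto simp: t_def R_def)
      moreover from this have "0 < (norm x)\<^sup>2 + 4 * (norm x * t) + t\<^sup>2"
        by (intro add_nonneg_pos add_nonneg_nonneg) auto
      moreover have "(3 * norm x + t)\<^sup>2 - (2 * (3 * norm x + t) * norm x + (norm x)\<^sup>2)
          = (norm x)\<^sup>2 + ((norm x)\<^sup>2 + 4 * (norm x * t) + t\<^sup>2)"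
        by (simp add: power2_eq_square algebra_simps)
      ultimately show ?thesis by simp
    qed
    ultimately show ?thesis by (simp add: quad_norm_def norm_power)
  qed
  have R: "R \<ge> 0" by (simp add: R_def)
  then obtain z0 where z0: "z0 \<in> cball 0 R" "\<And>w. w \<in> cball 0 R \<Longrightarrow> quad_norm x z0 \<le> quad_norm x w"
    using continuous_attains_inf[OF compact_cball _ cont, of 0 R] by auto
  have min: "quad_norm x z0 \<le> quad_norm x w" for w
  proof (cases "R < norm w")
    case True
    then show ?thesis using big[OF True] z0(2)[of 0] R by simp
  qed (use z0(2) in auto)
  define T where "T = {w. quad_norm x w = quad_norm x z0}"
  have "T \<subseteq> cball 0 R"
  proof
    fix w assume "w \<in> T"
    then have "quad_norm x w \<le> quad_norm x 0" using min[of 0] by (simp add: T_def)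
    then have "\<not> R < norm w" using big[of w] by linarith
    then show "w \<in> cball 0 R" by simp
  qed
  moreover have "closed T"
    unfolding T_def by (intro closed_Collect_eq cont continuous_on_const)
  ultimately have "compact T"
    by (metis bounded_cball bounded_subset compact_eq_bounded_closed)
  moreover have "z0 \<in> T" by (simp add: T_def)
  ultimately obtain z where "z \<in> T" "\<And>w. w \<in> T \<Longrightarrow> norm w \<le> norm z"
    using continuous_attains_sup[of T norm] by (force intro: continuous_on_norm_id)
  then show ?thesis using min by (intro that[of z]) (auto simp: T_def)
qed

text \<open>Ostrowski's argument: if the minimum \<open>m\<close> of \<open>quad_norm x\<close> were positive, a slightly
  larger root \<open>z\<^sub>1\<close> would have \<open>quad_norm x z\<^sub>1 \<le> m\<close> as well, contradicting the maximal choice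
  of the minimiser.\<close>
lemma real_normed_field_quadratic:
  fixes x :: "'k::real_normed_field"
  obtains a b :: real where "(x - of_real a)\<^sup>2 + (of_real b)\<^sup>2 = 0"
proof -
  obtain z where min: "\<And>w. quad_norm x z \<le> quad_norm x w"
    and max: "\<And>w. quad_norm x w = quad_norm x z \<Longrightarrow> norm w \<le> norm z"
    by (rule quad_norm_attains_inf[of x]) blast
  define m where "m = quad_norm x z"
  have "m = 0"
  proof (rule ccontr)
    assume "m \<noteq> 0"
    then have m: "m > 0" by (simp add: m_def quad_norm_def)
    define \<epsilon> where "\<epsilon> = m / 2"
    have \<epsilon>: "\<epsilon> > 0" using m by (simp add: \<epsilon>_def)
    \<comment> \<open>Raising the squared imaginary part by \<epsilon> gives u(z1) = -\<epsilon> for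
      the quadratic \<open>u\<close> below, whose roots are z and \<open>cnj z\<close>. It also
      makes z1 larger in modulus than z, hence not a minimiser.\<close>
    define z1 where "z1 = Complex (Re z) (sqrt ((Im z)\<^sup>2 + \<epsilon>))"
    have "(norm z)\<^sup>2 < (norm z1)\<^sup>2" using \<epsilon> by (simp add: z1_def cmod_power2)
    then have "norm z < norm z1" by (simp add: power_less_imp_less_base)
    then have "m < quad_norm x z1"
      using min[of z1] max[of z1] by (force simp: m_def)
    define u where "u = [:(Re z)\<^sup>2 + (Im z)\<^sup>2, - 2 * Re z, 1 :: complex:]"
    have uI: "poly_Im u x = 0" by (simp add: u_def power2_eq_square)
    have uR: "poly_Re u x = (x - of_real (Re z))\<^sup>2 + (of_real (Im z))\<^sup>2"
      by (simp add: u_def power2_eq_square algebra_simps)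
    have nu: "norm (poly_Re u x) = m" by (simp add: uR m_def quad_norm_def)
    have u1: "poly u z1 = - of_real \<epsilon>"
    proof -
      have "poly u z1 = (z1 - of_real (Re z))\<^sup>2 + (of_real (Im z))\<^sup>2"
        by (simp add: u_def power2_eq_square algebra_simps)
      also have "z1 - of_real (Re z) = \<i> * of_real (sqrt ((Im z)\<^sup>2 + \<epsilon>))"
        by (simp add: z1_def complex_eq_iff)
      also have "\<dots>\<^sup>2 = - of_real ((Im z)\<^sup>2 + \<epsilon>)"
        using \<epsilon> by (simp only: power_mult_distrib i_squared of_real_power[symmetric]) simp
      finally show ?thesis by simp
    qed
    have bound: "quad_norm x z1 * m ^ (2 * n - 1) \<le> (m ^ n + \<epsilon> ^ n)\<^sup>2" if n: "n > 0" for n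
    proof -
      \<comment> \<open>Subtracting the constant (-\<epsilon>)^n makes z1 a root. Removing the
        factor X - z1 leaves a monic cofactor of degree 2n - 1, to which the lower bound
        applies.\<close>
      define P where "P = u ^ n + [:- ((- of_real \<epsilon>) ^ n):]"
      have du: "degree u = 2" "lead_coeff u = 1" by (simp_all add: u_def)
      have "u \<noteq> 0" using du by auto
      then have "degree (u ^ n) = 2 * n" using du by (simp add: degree_power_eq)
      then have dP: "degree P = 2 * n" using n by (simp add: P_def degree_add_eq_left)
      have lP: "lead_coeff P = 1"
      proof -
        have "coeff (u ^ n) (2 * n) = 1"
          using du \<open>degree (u ^ n) = 2 * n\<close> by (metis lead_coeff_power power_one)
        then show ?thesis
          unfolding dP using n by (simp add: P_def coeff_pCons split: nat.split)
      qed
      have "poly P z1 = 0" by (simp add: P_def u1)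
      then obtain q where q: "P = [:-z1, 1:] * q" by (metis dvdE poly_eq_0_iff_dvd)
      have q0: "q \<noteq> 0" using q lP by auto
      have dq: "degree q = 2 * n - 1" using dP q0 by (simp add: q degree_mult_eq del: mult_pCons_left)
      have "lead_coeff q = 1" using lP by (simp add: q lead_coeff_mult del: mult_pCons_left)
      then have "m ^ (2 * n - 1) \<le> norm (poly_norm q x)"
        using quad_norm_poly_lower_bound[of m x q] min m dq by (simp add: m_def)
      then have "quad_norm x z1 * m ^ (2 * n - 1) \<le> quad_norm x z1 * norm (poly_norm q x)"
        by (intro mult_left_mono) (auto simp: quad_norm_def)
      also have "\<dots> = norm (poly_norm P x)"
        by (simp only: q poly_norm_mult norm_mult quad_norm_linear)
      \<comment> \<open>Both \<open>u\<close> and the constant have real values at \<open>x\<close>,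
        so \<open>poly_norm P x\<close> is a plain square.\<close>
      also have "\<dots> = (norm (poly_Re u x ^ n - (- of_real \<epsilon>) ^ n))\<^sup>2"
      proof -
        have c: "(- of_real \<epsilon> :: complex) ^ n = of_real ((- \<epsilon>) ^ n)" by simp
        have "poly_Re P x = poly_Re u x ^ n - (- of_real \<epsilon>) ^ n" "poly_Im P x = 0"
          using poly_power_real[OF uI, of n]
          unfolding P_def c by (simp_all only: poly_Re_add poly_Im_add poly_Re_pCons poly_Im_pCons) auto
        then show ?thesis by (simp add: poly_norm_def norm_power)
      qed
      also have "\<dots> \<le> (m ^ n + \<epsilon> ^ n)\<^sup>2"
      proof (rule power_mono)
        have "norm (poly_Re u x ^ n - (- of_real \<epsilon>) ^ n)
            \<le> norm (poly_Re u x ^ n) + norm ((- of_real \<epsilon> :: 'k) ^ n)" by (rule norm_triangle_ineq4)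
        then show "norm (poly_Re u x ^ n - (- of_real \<epsilon>) ^ n) \<le> m ^ n + \<epsilon> ^ n"
          using \<epsilon> by (simp add: norm_power nu)
      qed simp
      finally show ?thesis .
    qed
    \<comment> \<open>Since \<epsilon> = m/2, both sides carry the factor m^(2n - 1). Cancelling it
      leaves m (1 + 2^-n)^2, which tends to m.\<close>
    have ineq: "quad_norm x z1 \<le> m * (1 + (1/2) ^ n)\<^sup>2" if n: "n > 0" for n
    proof -
      have "m ^ n + \<epsilon> ^ n = m ^ n * (1 + (1/2) ^ n)"
        by (simp add: \<epsilon>_def power_divide field_simps)
      moreover have "(m ^ n)\<^sup>2 = m * m ^ (2 * n - 1)"
        using n by (simp add: power_mult[symmetric] mult.commute[of n] flip: power_Suc)
      ultimately have "quad_norm x z1 * m ^ (2 * n - 1) \<le> (m * (1 + (1/2) ^ n)\<^sup>2) * m ^ (2 * n - 1)"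
        using bound[OF n] by (simp add: power_mult_distrib mult_ac)
      then show ?thesis using m by simp
    qed
    have "(\<lambda>n. m * (1 + (1/2::real) ^ n)\<^sup>2) \<longlonglongrightarrow> m * (1 + 0)\<^sup>2"
      by (intro tendsto_intros LIMSEQ_realpow_zero) auto
    moreover have "\<forall>\<^sub>F n in sequentially. quad_norm x z1 \<le> m * (1 + (1/2) ^ n)\<^sup>2"
      using eventually_gt_at_top[of 0] by (rule eventually_mono) (rule ineq)
    ultimately have "quad_norm x z1 \<le> m"
      using tendsto_lowerbound[of _ _ sequentially] by force
    with \<open>m < quad_norm x z1\<close> show False by simp
  qed
  then show ?thesis by (intro that[of "Re z" "Im z"]) (simp add: m_def quad_norm_def)
qed

text \<open>The class \<open>real_normed_field\<close> does not include completeness; absolute convergence is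
  transported from the complex numbers along \<open>e\<close>.\<close>
lemma real_normed_field_complex_cover:
  obtains e :: "complex \<Rightarrow> 'k::real_normed_field" and g
  where "bounded_linear e" "\<And>x. e (g x) = x" "\<And>x. norm (g x) \<le> 2 * norm x"
proof (cases "\<exists>j::'k. j\<^sup>2 = - 1")
  case True
  then obtain j :: 'k where j: "j\<^sup>2 = - 1" by blast
  have nj: "norm j = 1"
    using arg_cong[OF j, of norm] by (simp add: norm_power abs_square_eq_1)
  \<comment> \<open>The real algebra map from the complex numbers sending the imaginary unit to
    \<open>j\<close>. It is onto because the quadratic relation for x gives x = a + bj or x = a -
    bj.\<close>
  define e where "e z = of_real (Re z) + of_real (Im z) * j" for z
  have lin: "bounded_linear e"
    unfolding e_def
    by (intro bounded_linear_add bounded_linear_of_real[THEN bounded_linear_compose]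
        bounded_linear_Re bounded_linear_Im bounded_linear_mult_const)
  have ex: "\<exists>z. e z = x" for x
  proof -
    obtain a b where ab: "(x - of_real a)\<^sup>2 + (of_real b)\<^sup>2 = 0"
      by (rule real_normed_field_quadratic)
    have "(x - of_real a)\<^sup>2 = (of_real b * j)\<^sup>2"
      using ab by (simp add: power_mult_distrib j eq_neg_iff_add_eq_0)
    then have "x - of_real a = of_real b * j \<or> x - of_real a = - (of_real b * j)"
      by (simp only: power2_eq_iff)
    then have "x = e (Complex a b) \<or> x = e (Complex a (- b))"
      by (auto simp: e_def algebra_simps)
    then show ?thesis by metis
  qed
  \<comment> \<open>The product of \<open>e z\<close> and \<open>e (cnj z)\<close> is the real
    number |z|^2, and the second factor has norm at most 2|z|; so \<open>e\<close> is bounded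
    below.\<close>
  have bound: "norm z \<le> 2 * norm (e z)" for z
  proof (cases "z = 0")
    case False
    have "of_real ((norm z)\<^sup>2) = e z * e (cnj z)"
    proof -
      have "e z * e (cnj z) = (of_real (Re z))\<^sup>2 - (of_real (Im z))\<^sup>2 * j\<^sup>2"
        by (simp add: e_def power2_eq_square algebra_simps)
      then show ?thesis by (simp only: j cmod_power2) simp
    qed
    then have "norm (of_real ((norm z)\<^sup>2) :: 'k) = norm (e z) * norm (e (cnj z))"
      by (simp add: norm_mult)
    then have "(norm z)\<^sup>2 = norm (e z) * norm (e (cnj z))"
      by (simp only: norm_of_real) simp
    moreover
    have "norm (e (cnj z)) \<le> \<bar>Re z\<bar> + \<bar>Im z\<bar>"
      unfolding e_def by (rule order_trans[OF norm_triangle_ineq]) (simp add: norm_mult nj)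
    then have "norm (e (cnj z)) \<le> 2 * norm z"
      using abs_Re_le_cmod[of z] abs_Im_le_cmod[of z] by simp
    then have "norm (e z) * norm (e (cnj z)) \<le> norm (e z) * (2 * norm z)"
      by (intro mult_left_mono) auto
    ultimately have "norm z * norm z \<le> (2 * norm (e z)) * norm z"
      by (simp add: power2_eq_square mult_ac)
    then show ?thesis using False by simp
  qed (simp add: e_def)
  define g where "g x = (SOME z. e z = x)" for x
  have "e (g x) = x" for x unfolding g_def by (rule someI_ex) (rule ex)
  with lin bound show ?thesis by (intro that[of e g]) metis+
next
  case False
  \<comment> \<open>Without a square root of -1, the quadratic relation for x forces b = 0, so every
    element is real.\<close>
  have ex: "\<exists>r. of_real r = x" for x :: 'k
  proof -
    obtain a b where ab: "(x - of_real a)\<^sup>2 + (of_real b)\<^sup>2 = 0"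
      by (rule real_normed_field_quadratic)
    have "b = 0"
    proof (rule ccontr)
      assume "b \<noteq> 0"
      then have "((x - of_real a) / of_real b)\<^sup>2 = - 1"
        using ab by (simp add: power_divide field_simps eq_neg_iff_add_eq_0)
      then show False using False by blast
    qed
    then show ?thesis using ab by auto
  qed
  define g where "g x = complex_of_real (SOME r. of_real r = x)" for x :: 'k
  have "of_real (Re (g x)) = x" for x
    unfolding g_def using someI_ex[OF ex[of x]] by simp
  moreover have "norm (g x) \<le> 2 * norm x" for x
    using someI_ex[OF ex[of x]] norm_of_real[of "SOME r. of_real r = x", where ?'a = 'k]
    by (auto simp: g_def)
  ultimately show ?thesis
    by (intro that[of "\<lambda>z. of_real (Re z)" g]
        bounded_linear_of_real[THEN bounded_linear_compose] bounded_linear_Re)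
qed

text \<open>The terms are lifted along \<open>g\<close>, summed in the complex numbers, and the sum
  is pushed down by the bounded linear \<open>e\<close>.\<close>

lemma norm_summable_imp_summable:
  fixes f :: "'i \<Rightarrow> 'k::real_normed_field"
  assumes "(\<lambda>i. norm (f i)) summable_on A"
  shows "f summable_on A"
proof -
  obtain e :: "complex \<Rightarrow> 'k" and g where eg: "bounded_linear e" "\<And>x. e (g x) = x"
    "\<And>x. norm (g x) \<le> 2 * norm x"
    by (rule real_normed_field_complex_cover) blast
  have "(\<lambda>i. 2 * norm (f i)) summable_on A" using assms by (rule summable_on_cmult_right)
  then have "(\<lambda>i. norm (g (f i))) summable_on A"
    by (rule Infinite_Sum.abs_summable_on_comparison_test') (rule eg)
  then have "(\<lambda>i. g (f i)) summable_on A" by (rule abs_summable_summable)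
  from summable_on_bounded_linear[OF eg(1) this] show ?thesis by (simp add: eg)
qed

subsection \<open>Power series on polydiscs\<close>

text \<open>Closed, so that it contains the corner with offset \<rho> from \<open>a\<close> in every
  coordinate; absolute convergence at that corner is summability of the majorant.\<close>

definition polydisc :: "'k::real_normed_field ^ 'a::finite \<Rightarrow> real \<Rightarrow> ('k ^ 'a) set" where
  "polydisc a \<rho> = {x. \<forall>i. norm ((x - a) $ i) \<le> \<rho>}"

abbreviation deg :: "('a::finite \<Rightarrow> nat) \<Rightarrow> nat" where
  "deg \<alpha> \<equiv> sum \<alpha> UNIV"

text \<open>The weighted l1-norm of the coefficients at \<open>a\<close> is at most M. At a fixed
  radius this is a Banach algebra norm, so closure properties come with explicit bounds.\<close>

definition ps_bounded :: "'k::real_normed_field ^ 'a::finite \<Rightarrow> real \<Rightarrow> real \<Rightarrow> ('k ^ 'a \<Rightarrow> 'k) \<Rightarrow> bool" where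
  "ps_bounded a \<rho> M \<phi> \<longleftrightarrow> 0 < \<rho> \<and> (\<exists>c N.
     ((\<lambda>\<alpha>. norm (c \<alpha>) * \<rho> ^ deg \<alpha>) has_sum N) UNIV \<and> N \<le> M \<and>
     (\<forall>x\<in>polydisc a \<rho>. ((\<lambda>\<alpha>. c \<alpha> * monom \<alpha> (x - a)) has_sum \<phi> x) UNIV))"

lemma ps_boundedE:
  assumes "ps_bounded a \<rho> M \<phi>"
  obtains c N where "0 < \<rho>" "((\<lambda>\<alpha>. norm (c \<alpha>) * \<rho> ^ deg \<alpha>) has_sum N) UNIV" "N \<le> M"
    "\<And>x. x \<in> polydisc a \<rho> \<Longrightarrow> ((\<lambda>\<alpha>. c \<alpha> * monom \<alpha> (x - a)) has_sum \<phi> x) UNIV"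
  using assms unfolding ps_bounded_def by blast

lemma monom_mult: "monom (\<lambda>i. \<alpha> i + \<beta> i) v = monom \<alpha> v * monom \<beta> v"
  by (simp add: monom_def power_add prod.distrib)

lemma monom_0 [simp]: "monom (\<lambda>_. 0) v = 1"
  by (simp add: monom_def)

lemma monom_single [simp]: "monom (\<lambda>j. if j = i then 1 else 0) v = v $ i"
proof -
  have "monom (\<lambda>j. if j = i then 1 else 0) v = (\<Prod>j\<in>UNIV. if j = i then v $ j else 1)"
    unfolding monom_def by (intro prod.cong) auto
  then show ?thesis by simp
qed

lemma deg_single [simp]: "deg (\<lambda>j. if j = i then 1 else 0) = 1"
  by simp

lemma norm_monom_le:
  assumes "\<And>i. norm (v $ i) \<le> \<rho>"
  shows "norm (monom \<alpha> v) \<le> \<rho> ^ deg \<alpha>"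
proof -
  have "norm (monom \<alpha> v) \<le> (\<Prod>i\<in>UNIV. \<rho> ^ \<alpha> i)"
    unfolding monom_def prod_norm[symmetric] norm_power
    by (intro prod_mono) (auto intro: power_mono assms)
  then show ?thesis by (simp add: power_sum)
qed

lemma norm_term_le:
  assumes "x \<in> polydisc a \<rho>"
  shows "norm (c * monom \<alpha> (x - a)) \<le> norm c * \<rho> ^ deg \<alpha>"
  using assms by (auto simp: norm_mult polydisc_def intro!: mult_left_mono norm_monom_le)

text \<open>Terms with equal exponents may be collected; all closure properties of
  \<open>ps_bounded\<close> are instances.\<close>
lemma ps_boundedI:
  fixes f :: "'i \<Rightarrow> 'k::real_normed_field"
  assumes \<rho>: "0 < \<rho>"
    and N: "((\<lambda>i. norm (f i) * \<rho> ^ deg (\<kappa> i)) has_sum N) I" "N \<le> M"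
    and \<phi>: "\<And>x. x \<in> polydisc a \<rho> \<Longrightarrow> ((\<lambda>i. f i * monom (\<kappa> i) (x - a)) has_sum \<phi> x) I"
  shows "ps_bounded a \<rho> M \<phi>"
proof -
  \<comment> \<open>Indices with the same exponent form a fibre. \<open>I\<close> is the disjoint
    union of the fibres, so a sum over \<open>I\<close> becomes an iterated sum over exponents and
    fibres.\<close>
  define fib where "fib \<gamma> = {i\<in>I. \<kappa> i = \<gamma>}" for \<gamma>
  have bij: "bij_betw snd (Sigma UNIV fib) I"
    by (rule bij_betwI[where g = "\<lambda>i. (\<kappa> i, i)"]) (auto simp: fib_def)
  have collect: "(h has_sum s) UNIV"
    if "(g has_sum s) I" "\<And>\<gamma>. (g has_sum h \<gamma>) (fib \<gamma>)"
    for g h and s :: "'c::{topological_comm_monoid_add, t3_space}"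
  proof (rule has_sum_SigmaD)
    show "((\<lambda>p. g (snd p)) has_sum s) (Sigma UNIV fib)"
      using that(1) by (simp add: has_sum_reindex_bij_betw[OF bij])
  qed (use that(2) in simp)
  \<comment> \<open>On a fibre the weight is a positive constant and can be divided out.\<close>
  have sf: "(\<lambda>i. norm (f i)) summable_on fib \<gamma>" for \<gamma>
  proof -
    have "(\<lambda>i. norm (f i) * \<rho> ^ deg (\<kappa> i)) summable_on fib \<gamma>"
      using N(1) by (rule summable_on_subset_banach[OF has_sum_imp_summable]) (auto simp: fib_def)
    then have "(\<lambda>i. norm (f i) * \<rho> ^ deg \<gamma>) summable_on fib \<gamma>"
      by (rule summable_on_cong[THEN iffD1, rotated]) (simp add: fib_def)
    then show ?thesis using \<rho> by (simp add: summable_on_cmult_left')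
  qed
  define c where "c \<gamma> = infsum f (fib \<gamma>)" for \<gamma>
  define n where "n \<gamma> = infsum (\<lambda>i. norm (f i)) (fib \<gamma>)" for \<gamma>
  have c: "(f has_sum c \<gamma>) (fib \<gamma>)" for \<gamma>
    unfolding c_def using norm_summable_imp_summable[OF sf] by simp
  have n: "((\<lambda>i. norm (f i)) has_sum n \<gamma>) (fib \<gamma>)" for \<gamma>
    unfolding n_def using sf by simp
  have "((\<lambda>\<gamma>. n \<gamma> * \<rho> ^ deg \<gamma>) has_sum N) UNIV"
  proof (rule collect[OF N(1)])
    show "((\<lambda>i. norm (f i) * \<rho> ^ deg (\<kappa> i)) has_sum n \<gamma> * \<rho> ^ deg \<gamma>) (fib \<gamma>)" for \<gamma>
      using has_sum_cmult_left[OF n, of "\<rho> ^ deg \<gamma>"]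
      by (rule has_sum_cong[THEN iffD1, rotated]) (simp add: fib_def)
  qed
  moreover have le: "norm (c \<gamma>) * \<rho> ^ deg \<gamma> \<le> n \<gamma> * \<rho> ^ deg \<gamma>" for \<gamma>
    using norm_has_sum_bound[OF n c] \<rho> by (simp add: mult_right_mono)
  ultimately have s: "(\<lambda>\<gamma>. norm (c \<gamma>) * \<rho> ^ deg \<gamma>) summable_on UNIV"
    using \<rho> by (intro summable_on_comparison_test[OF has_sum_imp_summable]) auto
  have "infsum (\<lambda>\<gamma>. norm (c \<gamma>) * \<rho> ^ deg \<gamma>) UNIV \<le> N"
    using \<open>((\<lambda>\<gamma>. n \<gamma> * \<rho> ^ deg \<gamma>) has_sum N) UNIV\<close> le
    by (intro has_sum_mono[OF has_sum_infsum[OF s]])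
  moreover have "((\<lambda>\<gamma>. c \<gamma> * monom \<gamma> (x - a)) has_sum \<phi> x) UNIV" if "x \<in> polydisc a \<rho>" for x
  proof (rule collect[OF \<phi>[OF that]])
    show "((\<lambda>i. f i * monom (\<kappa> i) (x - a)) has_sum c \<gamma> * monom \<gamma> (x - a)) (fib \<gamma>)" for \<gamma>
      using has_sum_cmult_left[OF c, of "monom \<gamma> (x - a)"]
      by (rule has_sum_cong[THEN iffD1, rotated]) (simp add: fib_def)
  qed
  ultimately show ?thesis
    unfolding ps_bounded_def using \<rho> has_sum_infsum[OF s] N(2) by (meson order_trans)
qed

lemma ps_bounded_pos: "ps_bounded a \<rho> M \<phi> \<Longrightarrow> 0 < \<rho>"
  by (simp add: ps_bounded_def)

text \<open>The weighted l1-norm dominates the supremum norm on the polydisc.\<close>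

lemma ps_bounded_norm_le:
  assumes "ps_bounded a \<rho> M \<phi>" "x \<in> polydisc a \<rho>"
  shows "norm (\<phi> x) \<le> M"
proof -
  obtain c N where N: "((\<lambda>\<alpha>. norm (c \<alpha>) * \<rho> ^ deg \<alpha>) has_sum N) UNIV" "N \<le> M"
    and \<phi>: "\<And>x. x \<in> polydisc a \<rho> \<Longrightarrow> ((\<lambda>\<alpha>. c \<alpha> * monom \<alpha> (x - a)) has_sum \<phi> x) UNIV"
    using assms(1) by (rule ps_boundedE) blast
  have s: "(\<lambda>\<alpha>. norm (c \<alpha> * monom \<alpha> (x - a))) summable_on UNIV"
    using N(1) assms(2)
    by (intro summable_on_comparison_test[OF has_sum_imp_summable]) (auto intro: norm_term_le)
  have "norm (\<phi> x) \<le> infsum (\<lambda>\<alpha>. norm (c \<alpha> * monom \<alpha> (x - a))) UNIV"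
    by (rule norm_has_sum_bound[OF has_sum_infsum[OF s] \<phi>[OF assms(2)]])
  also have "\<dots> \<le> N"
    by (rule has_sum_mono[OF has_sum_infsum[OF s] N(1)]) (rule norm_term_le[OF assms(2)])
  finally show ?thesis using N(2) by simp
qed

lemma ps_bounded_nonneg:
  assumes "ps_bounded a \<rho> M \<phi>"
  shows "0 \<le> M"
proof -
  have "a \<in> polydisc a \<rho>" using ps_bounded_pos[OF assms] by (simp add: polydisc_def)
  then show ?thesis using ps_bounded_norm_le[OF assms] norm_ge_zero order_trans by blast
qed

lemma ps_bounded_mono:
  assumes "ps_bounded a \<rho> M \<phi>" "M \<le> M'"
  shows "ps_bounded a \<rho> M' \<phi>"
  using assms unfolding ps_bounded_def by (meson order_trans)

lemma ps_bounded_const: "0 < \<rho> \<Longrightarrow> ps_bounded a \<rho> (norm k) (\<lambda>_. k)"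
  by (rule ps_boundedI[where I = "{()}" and f = "\<lambda>_. k" and \<kappa> = "\<lambda>_ _. 0" and N = "norm k"])
    (auto intro!: has_sum_finiteI)

lemma ps_bounded_coord: "0 < \<rho> \<Longrightarrow> ps_bounded a \<rho> \<rho> (\<lambda>x. x $ i - a $ i)"
  by (rule ps_boundedI[where I = "{()}" and f = "\<lambda>_. 1"
        and \<kappa> = "\<lambda>_ j. if j = i then 1 else 0" and N = \<rho>])
    (auto intro!: has_sum_finiteI simp del: sum.delta)

text \<open>The coefficients of all members form one family over \<open>B \<times> UNIV\<close>,
  dominated by the summable bounds; \<open>ps_boundedI\<close> then collects equal
  exponents.\<close>

lemma ps_bounded_has_sum:
  assumes \<rho>: "0 < \<rho>" and p: "\<And>\<beta>. \<beta> \<in> B \<Longrightarrow> ps_bounded a \<rho> (M \<beta>) (\<phi> \<beta>)"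
    and M: "(M has_sum N) B"
    and \<Phi>: "\<And>x. x \<in> polydisc a \<rho> \<Longrightarrow> ((\<lambda>\<beta>. \<phi> \<beta> x) has_sum \<Phi> x) B"
  shows "ps_bounded a \<rho> N \<Phi>"
proof -
  have "\<forall>\<beta>\<in>B. \<exists>c n. ((\<lambda>\<alpha>. norm (c \<alpha>) * \<rho> ^ deg \<alpha>) has_sum n) UNIV \<and> n \<le> M \<beta> \<and>
     (\<forall>x\<in>polydisc a \<rho>. ((\<lambda>\<alpha>. c \<alpha> * monom \<alpha> (x - a)) has_sum \<phi> \<beta> x) UNIV)"
    using p unfolding ps_bounded_def by blast
  from bchoice[OF this] obtain c where "\<forall>\<beta>\<in>B. \<exists>n.
      ((\<lambda>\<alpha>. norm (c \<beta> \<alpha>) * \<rho> ^ deg \<alpha>) has_sum n) UNIV \<and> n \<le> M \<beta> \<and>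
      (\<forall>x\<in>polydisc a \<rho>. ((\<lambda>\<alpha>. c \<beta> \<alpha> * monom \<alpha> (x - a)) has_sum \<phi> \<beta> x) UNIV)" by blast
  from bchoice[OF this] obtain n where n: "\<And>\<beta>. \<beta> \<in> B \<Longrightarrow> ((\<lambda>\<alpha>. norm (c \<beta> \<alpha>) * \<rho> ^ deg \<alpha>) has_sum n \<beta>) UNIV"
    "\<And>\<beta>. \<beta> \<in> B \<Longrightarrow> n \<beta> \<le> M \<beta>"
    and \<phi>: "\<And>\<beta> x. \<beta> \<in> B \<Longrightarrow> x \<in> polydisc a \<rho> \<Longrightarrow>
      ((\<lambda>\<alpha>. c \<beta> \<alpha> * monom \<alpha> (x - a)) has_sum \<phi> \<beta> x) UNIV"
    by blast
  have n0: "0 \<le> n \<beta>" if "\<beta> \<in> B" for \<beta>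
    by (rule has_sum_nonneg[OF n(1)[OF that]]) (use \<rho> in auto)
  have sn: "n summable_on B"
    using M n(2) n0 by (intro summable_on_comparison_test[OF has_sum_imp_summable])
  have s: "(\<lambda>p. norm (c (fst p) (snd p)) * \<rho> ^ deg (snd p)) summable_on (B \<times> UNIV)"
    by (rule summable_on_SigmaI[where g = n]) (use n sn \<rho> in auto)
  have "infsum n B \<le> N"
    by (rule has_sum_mono[OF has_sum_infsum[OF sn] M n(2)])
  moreover have "infsum n B = infsum (\<lambda>p. norm (c (fst p) (snd p)) * \<rho> ^ deg (snd p)) (B \<times> UNIV)"
    by (rule infsumI, rule has_sum_SigmaD[OF has_sum_infsum[OF s]]) (use n in simp)
  ultimately show ?thesis
  proof (intro ps_boundedI[where I = "B \<times> UNIV" and f = "\<lambda>p. c (fst p) (snd p)" and \<kappa> = snd])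
    show "((\<lambda>p. norm (c (fst p) (snd p)) * \<rho> ^ deg (snd p)) has_sum infsum n B) (B \<times> UNIV)"
      using \<open>infsum n B = _\<close> has_sum_infsum[OF s] by simp
    fix x assume x: "x \<in> polydisc a \<rho>"
    have "(\<lambda>p. c (fst p) (snd p) * monom (snd p) (x - a)) summable_on (B \<times> UNIV)"
      by (rule norm_summable_imp_summable, rule summable_on_comparison_test[OF s])
        (auto intro: norm_term_le[OF x])
    then show "((\<lambda>p. c (fst p) (snd p) * monom (snd p) (x - a)) has_sum \<Phi> x) (B \<times> UNIV)"
      by (rule has_sum_SigmaI[rotated 2]) (use \<phi> \<Phi> x in auto)
  qed (use \<rho> in auto)
qed

lemma ps_bounded_add:
  assumes "ps_bounded a \<rho> M \<phi>" "ps_bounded a \<rho> N \<psi>"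
  shows "ps_bounded a \<rho> (M + N) (\<lambda>x. \<phi> x + \<psi> x)"
  by (rule ps_bounded_has_sum[where B = UNIV and \<phi> = "\<lambda>b. if b then \<phi> else \<psi>"
        and M = "\<lambda>b. if b then M else N"])
    (use assms ps_bounded_pos in \<open>auto simp: UNIV_bool intro!: has_sum_finiteI\<close>)

text \<open>Cauchy product: pairs of exponents index the terms, the weight is multiplicative on
  pairs, and pairs with equal sum are collected.\<close>

lemma ps_bounded_mult:
  assumes "ps_bounded a \<rho> M \<phi>" "ps_bounded a \<rho> N \<psi>"
  shows "ps_bounded a \<rho> (M * N) (\<lambda>x. \<phi> x * \<psi> x)"
proof -
  obtain c m where \<rho>: "0 < \<rho>" and m: "((\<lambda>\<alpha>. norm (c \<alpha>) * \<rho> ^ deg \<alpha>) has_sum m) UNIV" "m \<le> M"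
    and \<phi>: "\<And>x. x \<in> polydisc a \<rho> \<Longrightarrow> ((\<lambda>\<alpha>. c \<alpha> * monom \<alpha> (x - a)) has_sum \<phi> x) UNIV"
    using assms(1) by (rule ps_boundedE) blast
  obtain d n where n: "((\<lambda>\<alpha>. norm (d \<alpha>) * \<rho> ^ deg \<alpha>) has_sum n) UNIV" "n \<le> N"
    and \<psi>: "\<And>x. x \<in> polydisc a \<rho> \<Longrightarrow> ((\<lambda>\<alpha>. d \<alpha> * monom \<alpha> (x - a)) has_sum \<psi> x) UNIV"
    using assms(2) by (rule ps_boundedE) blast
  have inner: "((\<lambda>\<beta>. (norm (c \<alpha>) * \<rho> ^ deg \<alpha>) * (norm (d \<beta>) * \<rho> ^ deg \<beta>)) has_sum
      (norm (c \<alpha>) * \<rho> ^ deg \<alpha>) * n) UNIV" for \<alpha>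
    by (rule has_sum_cmult_right[OF n(1)])
  have outer: "((\<lambda>\<alpha>. (norm (c \<alpha>) * \<rho> ^ deg \<alpha>) * n) has_sum m * n) UNIV"
    by (rule has_sum_cmult_left[OF m(1)])
  have s: "((\<lambda>p. (norm (c (fst p)) * \<rho> ^ deg (fst p)) * (norm (d (snd p)) * \<rho> ^ deg (snd p)))
      has_sum m * n) (UNIV \<times> UNIV)"
    by (rule has_sum_SigmaI[OF _ outer], simp, rule inner,
        rule summable_on_SigmaI[OF _ has_sum_imp_summable[OF outer]], simp, rule inner)
      (use \<rho> in auto)
  show ?thesis
  proof (intro ps_boundedI[where I = "UNIV \<times> UNIV" and f = "\<lambda>p. c (fst p) * d (snd p)"
        and \<kappa> = "\<lambda>p i. fst p i + snd p i" and N = "m * n"])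
    show "((\<lambda>p. norm (c (fst p) * d (snd p)) * \<rho> ^ deg (\<lambda>i. fst p i + snd p i)) has_sum m * n)
        (UNIV \<times> UNIV)"
      using s by (simp add: norm_mult sum.distrib power_add mult_ac)
    show "m * n \<le> M * N"
      using m n has_sum_nonneg[OF m(1)] has_sum_nonneg[OF n(1)] \<rho>
      by (intro mult_mono) (auto intro: order_trans)
    fix x assume x: "x \<in> polydisc a \<rho>"
    have e: "c (fst p) * d (snd p) * monom (\<lambda>i. fst p i + snd p i) (x - a)
        = (c (fst p) * monom (fst p) (x - a)) * (d (snd p) * monom (snd p) (x - a))" for p
      by (simp add: monom_mult mult_ac)
    have "(\<lambda>p. norm ((c (fst p) * monom (fst p) (x - a)) * (d (snd p) * monom (snd p) (x - a))))
        summable_on (UNIV \<times> UNIV)"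
      by (rule summable_on_comparison_test[OF has_sum_imp_summable[OF s]])
        (auto simp only: norm_mult[of "_ * monom _ _" "_ * monom _ _"] zero_le_mult_iff norm_ge_zero
          intro!: mult_mono norm_term_le[OF x] mult_nonneg_nonneg zero_le_power less_imp_le[OF \<rho>])
    note s' = norm_summable_imp_summable[OF this]
    show "((\<lambda>p. c (fst p) * d (snd p) * monom (\<lambda>i. fst p i + snd p i) (x - a)) has_sum
        \<phi> x * \<psi> x) (UNIV \<times> UNIV)"
      unfolding e
      by (rule has_sum_SigmaI[OF _ has_sum_cmult_left[OF \<phi>[OF x]] s'], simp)
        (rule has_sum_cmult_right[OF \<psi>[OF x]])
  qed (rule \<rho>)
qed

lemma ps_bounded_power:
  assumes "ps_bounded a \<rho> M \<phi>"
  shows "ps_bounded a \<rho> (M ^ n) (\<lambda>x. \<phi> x ^ n)"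
proof (induction n)
  case 0
  show ?case using ps_bounded_const[OF ps_bounded_pos[OF assms], where k = 1] by simp
qed (simp add: ps_bounded_mult assms)

lemma ps_bounded_prod:
  assumes \<rho>: "0 < \<rho>" and "finite J" and "\<And>j. j \<in> J \<Longrightarrow> ps_bounded a \<rho> (M j) (\<phi> j)"
  shows "ps_bounded a \<rho> (prod M J) (\<lambda>x. \<Prod>j\<in>J. \<phi> j x)"
  using assms(2,3)
proof (induction J)
  case empty
  show ?case using ps_bounded_const[OF \<rho>, where k = 1] by simp
qed (simp add: ps_bounded_mult)

text \<open>The coordinates of G - b have norm at most R, so the monomial \<beta> in them has norm
  at most R ^ deg \<beta>. The substituted series is dominated by the majorant of \<phi>.\<close>

lemma ps_bounded_compose:
  assumes \<phi>: "ps_bounded b R M \<phi>"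
    and G: "0 < \<rho>" "\<And>j. ps_bounded a \<rho> R (\<lambda>x. G x $ j - b $ j)"
  shows "ps_bounded a \<rho> M (\<lambda>x. \<phi> (G x))"
proof -
  obtain d N where N: "((\<lambda>\<beta>. norm (d \<beta>) * R ^ deg \<beta>) has_sum N) UNIV" "N \<le> M"
    and \<phi>: "\<And>y. y \<in> polydisc b R \<Longrightarrow> ((\<lambda>\<beta>. d \<beta> * monom \<beta> (y - b)) has_sum \<phi> y) UNIV"
    using \<phi> by (rule ps_boundedE) blast
  have G': "ps_bounded a \<rho> R (\<lambda>x. (G x - b) $ j)" for j
    using G(2)[of j] by simp
  have terms: "ps_bounded a \<rho> (norm (d \<beta>) * R ^ deg \<beta>) (\<lambda>x. d \<beta> * monom \<beta> (G x - b))" for \<beta>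
    unfolding monom_def power_sum
    by (intro ps_bounded_mult ps_bounded_const ps_bounded_prod ps_bounded_power G(1) G') simp
  have "G x \<in> polydisc b R" if "x \<in> polydisc a \<rho>" for x
    using ps_bounded_norm_le[OF G(2) that] by (simp add: polydisc_def)
  from \<phi>[OF this] have "ps_bounded a \<rho> N (\<lambda>x. \<phi> (G x))"
    by (rule ps_bounded_has_sum[OF G(1) terms N(1)])
  then show ?thesis using N(2) by (rule ps_bounded_mono)
qed

lemma monom_zero_vec: "monom \<alpha> 0 = (if \<alpha> = (\<lambda>_. 0) then 1 else 0)"
  by (auto simp: monom_def fun_eq_iff power_0_left)

lemma ball_subset_polydisc: "ball a \<rho> \<subseteq> polydisc a \<rho>"
proof
  fix x assume "x \<in> ball a \<rho>"
  then have "norm (x - a) \<le> \<rho>" by (simp add: dist_norm norm_minus_commute)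
  then show "x \<in> polydisc a \<rho>"
    unfolding polydisc_def mem_Collect_eq by (blast intro: order_trans[OF Finite_Cartesian_Product.norm_nth_le])
qed

lemma eventually_polydisc: "0 < \<rho> \<Longrightarrow> \<forall>\<^sub>F x in nhds a. x \<in> polydisc a \<rho>"
  using ball_subset_polydisc[of a \<rho>]
  by (auto simp: eventually_nhds_metric dist_commute subset_iff intro!: exI[of _ \<rho>])

lemma polydisc_subset_ball:
  fixes a :: "'k::real_normed_field ^ 'a::finite"
  assumes "0 < r"
  shows "polydisc a (r / (2 * real CARD('a))) \<subseteq> ball a r"
proof
  fix x assume x: "x \<in> polydisc a (r / (2 * real CARD('a)))"
  have "norm (x - a) \<le> (\<Sum>i\<in>UNIV. norm ((x - a) $ i))"
    unfolding norm_vec_def by (rule L2_set_le_sum) simp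
  also have "\<dots> \<le> (\<Sum>i\<in>(UNIV::'a set). r / (2 * real CARD('a)))"
    using x by (intro sum_mono) (auto simp: polydisc_def)
  also have "\<dots> < r" using assms by simp
  finally show "x \<in> ball a r" by (simp add: dist_norm norm_minus_commute)
qed

lemma analytic_pt_iff_ps_bounded: "analytic_pt \<phi> a \<longleftrightarrow> (\<exists>\<rho> M. ps_bounded a \<rho> M \<phi>)"
  for a :: "'k::real_normed_field ^ 'a::finite"
proof
  assume "analytic_pt \<phi> a"
  then obtain r c where r: "r > 0"
    and s: "\<And>x. x \<in> ball a r \<Longrightarrow> (\<lambda>\<alpha>. norm (c \<alpha> * monom \<alpha> (x - a))) summable_on UNIV"
    and \<phi>: "\<And>x. x \<in> ball a r \<Longrightarrow> ((\<lambda>\<alpha>. c \<alpha> * monom \<alpha> (x - a)) has_sum \<phi> x) UNIV"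
    unfolding analytic_pt_def by blast
  define \<rho> where "\<rho> = r / (2 * real CARD('a))"
  have \<rho>: "0 < \<rho>" using r by (simp add: \<rho>_def)
  have sub: "polydisc a \<rho> \<subseteq> ball a r" unfolding \<rho>_def by (rule polydisc_subset_ball[OF r])
  \<comment> \<open>At this corner each monomial has norm exactly \<rho> ^ deg \<alpha>, so absolute
    convergence there is finiteness of the weighted l1-norm.\<close>
  define x where "x = a + (\<chi> i. of_real \<rho>)"
  have "x \<in> polydisc a \<rho>" using \<rho> by (simp add: polydisc_def x_def)
  with sub s have "(\<lambda>\<alpha>. norm (c \<alpha> * monom \<alpha> (x - a))) summable_on UNIV" by blast
  moreover have "norm (c \<alpha> * monom \<alpha> (x - a)) = norm (c \<alpha>) * \<rho> ^ deg \<alpha>" for \<alpha>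
    using \<rho> by (simp add: x_def monom_def norm_mult prod_norm[symmetric] norm_power power_sum)
  ultimately have "(\<lambda>\<alpha>. norm (c \<alpha>) * \<rho> ^ deg \<alpha>) summable_on UNIV" by simp
  from has_sum_infsum[OF this] \<phi> sub \<rho> show "\<exists>\<rho> M. ps_bounded a \<rho> M \<phi>"
    unfolding ps_bounded_def by (intro exI[of _ \<rho>] exI conjI exI[of _ c] ballI order_refl) blast+
next
  assume "\<exists>\<rho> M. ps_bounded a \<rho> M \<phi>"
  then obtain \<rho> M where "ps_bounded a \<rho> M \<phi>" by blast
  then obtain c N where \<rho>: "0 < \<rho>" and N: "((\<lambda>\<alpha>. norm (c \<alpha>) * \<rho> ^ deg \<alpha>) has_sum N) UNIV"
    and \<phi>: "\<And>x. x \<in> polydisc a \<rho> \<Longrightarrow> ((\<lambda>\<alpha>. c \<alpha> * monom \<alpha> (x - a)) has_sum \<phi> x) UNIV"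
    by (rule ps_boundedE) blast
  have "(\<lambda>\<alpha>. norm (c \<alpha> * monom \<alpha> (x - a))) summable_on UNIV" if "x \<in> ball a \<rho>" for x
    using that ball_subset_polydisc[of a \<rho>]
    by (intro summable_on_comparison_test[OF has_sum_imp_summable[OF N]]) (auto intro: norm_term_le)
  then show "analytic_pt \<phi> a"
    unfolding analytic_pt_def using \<rho> \<phi> ball_subset_polydisc[of a \<rho>] by blast
qed

text \<open>Composition with the identity, whose coordinates have norm at most \<rho>' around
  \<open>a\<close>.\<close>

lemma ps_bounded_shrink:
  assumes "ps_bounded a \<rho> M \<phi>" "0 < \<rho>'" "\<rho>' \<le> \<rho>"
  shows "ps_bounded a \<rho>' M \<phi>"
  using ps_bounded_compose[OF assms(1,2), of a "\<lambda>x. x"] assms(2,3)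
  by (simp add: ps_bounded_mono[OF ps_bounded_coord])

text \<open>Composition with the identity expanded around y: x_j - a_j = (x_j - y_j) + (y_j - a_j)
  has norm at most \<rho>/2 + \<rho>/2. The binomial rearrangement is absorbed in
  \<open>ps_bounded_compose\<close>.\<close>

lemma ps_bounded_recenter:
  assumes "ps_bounded a \<rho> M \<phi>" "y \<in> polydisc a (\<rho> / 2)"
  shows "ps_bounded y (\<rho> / 2) M \<phi>"
proof -
  have \<rho>: "0 < \<rho> / 2" using ps_bounded_pos[OF assms(1)] by simp
  have "ps_bounded y (\<rho> / 2) \<rho> (\<lambda>x. x $ j - a $ j)" for j
  proof -
    have "ps_bounded y (\<rho> / 2) (\<rho> / 2 + norm (y $ j - a $ j)) (\<lambda>x. (x $ j - y $ j) + (y $ j - a $ j))"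
      by (intro ps_bounded_add ps_bounded_coord ps_bounded_const \<rho>)
    moreover have "norm (y $ j - a $ j) \<le> \<rho> / 2"
      using assms(2) by (simp add: polydisc_def)
    ultimately show ?thesis by (auto elim!: ps_bounded_mono)
  qed
  from ps_bounded_compose[OF assms(1) \<rho>, of y "\<lambda>x. x", OF this] show ?thesis .
qed

text \<open>Without a constant term every monomial has positive degree and gains a factor
  \<rho>'/\<rho> when the radius shrinks. This makes inner maps as small as a composition
  requires.\<close>

lemma ps_bounded_vanishing:
  assumes p: "ps_bounded a \<rho> M \<phi>" and "\<phi> a = 0" and \<rho>': "0 < \<rho>'" "\<rho>' \<le> \<rho>"
  shows "ps_bounded a \<rho>' (\<rho>' / \<rho> * M) \<phi>"
proof -
  obtain c N where \<rho>: "0 < \<rho>" and N: "((\<lambda>\<alpha>. norm (c \<alpha>) * \<rho> ^ deg \<alpha>) has_sum N) UNIV" "N \<le> M"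
    and \<phi>: "\<And>x. x \<in> polydisc a \<rho> \<Longrightarrow> ((\<lambda>\<alpha>. c \<alpha> * monom \<alpha> (x - a)) has_sum \<phi> x) UNIV"
    using p by (rule ps_boundedE) blast
  have "((\<lambda>\<alpha>. c \<alpha> * monom \<alpha> (a - a)) has_sum c (\<lambda>_. 0)) UNIV"
    by (rule has_sum_finite_neutralI[of "{\<lambda>_. 0}"]) (auto simp: monom_zero_vec)
  moreover have "((\<lambda>\<alpha>. c \<alpha> * monom \<alpha> (a - a)) has_sum \<phi> a) UNIV"
    using \<rho> by (intro \<phi>) (simp add: polydisc_def)
  ultimately have c0: "c (\<lambda>_. 0) = 0" using assms(2) has_sum_unique by metis
  have le: "norm (c \<alpha>) * \<rho>' ^ deg \<alpha> \<le> \<rho>' / \<rho> * (norm (c \<alpha>) * \<rho> ^ deg \<alpha>)" for \<alpha>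
  proof (cases "\<alpha> = (\<lambda>_. 0)")
    case False
    then obtain i where "\<alpha> i > 0" by (auto simp: fun_eq_iff)
    moreover have "\<alpha> i \<le> deg \<alpha>" by (rule member_le_sum) auto
    ultimately have "deg \<alpha> > 0" by simp
    then obtain m where m: "deg \<alpha> = Suc m" using gr0_implies_Suc by blast
    have "norm (c \<alpha>) * (\<rho>' * \<rho>' ^ m) \<le> norm (c \<alpha>) * (\<rho>' * \<rho> ^ m)"
      using \<rho>' by (intro mult_left_mono power_mono) auto
    then show ?thesis unfolding m using \<rho> by (simp add: mult_ac)
  qed (use c0 in simp)
  have N': "((\<lambda>\<alpha>. \<rho>' / \<rho> * (norm (c \<alpha>) * \<rho> ^ deg \<alpha>)) has_sum \<rho>' / \<rho> * N) UNIV"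
    by (rule has_sum_cmult_right[OF N(1)])
  have s: "(\<lambda>\<alpha>. norm (c \<alpha>) * \<rho>' ^ deg \<alpha>) summable_on UNIV"
    by (rule summable_on_comparison_test[OF has_sum_imp_summable[OF N'] le]) (use \<rho>' in auto)
  have "infsum (\<lambda>\<alpha>. norm (c \<alpha>) * \<rho>' ^ deg \<alpha>) UNIV \<le> \<rho>' / \<rho> * N"
    by (rule has_sum_mono[OF has_sum_infsum[OF s] N' le])
  also have "\<dots> \<le> \<rho>' / \<rho> * M" using N(2) \<rho> \<rho>' by (intro mult_left_mono) auto
  finally have "infsum (\<lambda>\<alpha>. norm (c \<alpha>) * \<rho>' ^ deg \<alpha>) UNIV \<le> \<rho>' / \<rho> * M" .
  moreover have "polydisc a \<rho>' \<subseteq> polydisc a \<rho>"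
    using \<rho>' by (auto simp: polydisc_def intro: order_trans)
  ultimately show ?thesis
    unfolding ps_bounded_def using has_sum_infsum[OF s] \<phi> \<rho>'(1)
    by (intro conjI exI[of _ c] exI ballI) (auto simp only: subset_iff)
qed

section \<open>Closure properties of analytic functions\<close>

lemma analytic_pt_const [simp]: "analytic_pt (\<lambda>_. k) a"
  unfolding analytic_pt_iff_ps_bounded using ps_bounded_const[of 1] by fastforce

lemma analytic_pt_add:
  assumes "analytic_pt \<phi> a" "analytic_pt \<psi> a"
  shows "analytic_pt (\<lambda>x. \<phi> x + \<psi> x) a"
proof -
  obtain \<rho> M \<sigma> N where pq: "ps_bounded a \<rho> M \<phi>" "ps_bounded a \<sigma> N \<psi>"
    using assms unfolding analytic_pt_iff_ps_bounded by blast
  then have "0 < min \<rho> \<sigma>" by (auto dest: ps_bounded_pos)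
  with pq have "ps_bounded a (min \<rho> \<sigma>) M \<phi>" "ps_bounded a (min \<rho> \<sigma>) N \<psi>"
    by (auto intro: ps_bounded_shrink)
  then have "ps_bounded a (min \<rho> \<sigma>) (M + N) (\<lambda>x. \<phi> x + \<psi> x)"
    by (rule ps_bounded_add)
  then show ?thesis unfolding analytic_pt_iff_ps_bounded by blast
qed

lemma analytic_pt_mult:
  assumes "analytic_pt \<phi> a" "analytic_pt \<psi> a"
  shows "analytic_pt (\<lambda>x. \<phi> x * \<psi> x) a"
proof -
  obtain \<rho> M \<sigma> N where pq: "ps_bounded a \<rho> M \<phi>" "ps_bounded a \<sigma> N \<psi>"
    using assms unfolding analytic_pt_iff_ps_bounded by blast
  then have "0 < min \<rho> \<sigma>" by (auto dest: ps_bounded_pos)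
  with pq have "ps_bounded a (min \<rho> \<sigma>) M \<phi>" "ps_bounded a (min \<rho> \<sigma>) N \<psi>"
    by (auto intro: ps_bounded_shrink)
  then have "ps_bounded a (min \<rho> \<sigma>) (M * N) (\<lambda>x. \<phi> x * \<psi> x)"
    by (rule ps_bounded_mult)
  then show ?thesis unfolding analytic_pt_iff_ps_bounded by blast
qed

lemma analytic_pt_coord [simp]: "analytic_pt (\<lambda>x. x $ i) a"
proof -
  have "analytic_pt (\<lambda>x. x $ i - a $ i) a"
    unfolding analytic_pt_iff_ps_bounded using ps_bounded_coord[of 1] by fastforce
  from analytic_pt_add[OF this analytic_pt_const[of "a $ i"]] show ?thesis by simp
qed

lemma analytic_pt_diff:
  assumes "analytic_pt \<phi> a" "analytic_pt \<psi> a"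
  shows "analytic_pt (\<lambda>x. \<phi> x - \<psi> x) a"
  using analytic_pt_add[OF assms(1) analytic_pt_mult[OF analytic_pt_const[of "-1"] assms(2)]]
  by simp

lemma analytic_pt_sum:
  assumes "\<And>j. j \<in> J \<Longrightarrow> analytic_pt (\<phi> j) a"
  shows "analytic_pt (\<lambda>x. \<Sum>j\<in>J. \<phi> j x) a"
  using assms by (induction J rule: infinite_finite_induct) (auto intro: analytic_pt_add)

lemma analytic_pt_compose:
  fixes G :: "'k::real_normed_field ^ 'a::finite \<Rightarrow> 'k ^ 'b::finite"
  assumes \<phi>: "analytic_pt \<phi> (G a)" and G: "\<And>j. analytic_pt (\<lambda>x. G x $ j) a"
  shows "analytic_pt (\<lambda>x. \<phi> (G x)) a"
proof -
  obtain R M where R: "ps_bounded (G a) R M \<phi>"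
    using \<phi> unfolding analytic_pt_iff_ps_bounded by blast
  then have R0: "R > 0" by (rule ps_bounded_pos)
  have "\<exists>\<rho>. 0 < \<rho> \<and> (\<forall>\<rho>'. 0 < \<rho>' \<and> \<rho>' \<le> \<rho> \<longrightarrow> ps_bounded a \<rho>' R (\<lambda>x. G x $ j - G a $ j))" for j
  proof -
    have "analytic_pt (\<lambda>x. G x $ j - G a $ j) a"
      by (intro analytic_pt_diff G analytic_pt_const)
    then obtain \<sigma> N where N: "ps_bounded a \<sigma> N (\<lambda>x. G x $ j - G a $ j)"
      unfolding analytic_pt_iff_ps_bounded by blast
    note \<sigma> = ps_bounded_pos[OF N] and N0 = ps_bounded_nonneg[OF N]
    \<comment> \<open>Chosen so that the shrunken norm \<rho>'/\<sigma> * N is at most R; N + 1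
      keeps the denominator positive when N = 0.\<close>
    define \<rho> where "\<rho> = min \<sigma> (\<sigma> * R / (N + 1))"
    have "ps_bounded a \<rho>' R (\<lambda>x. G x $ j - G a $ j)" if "0 < \<rho>'" "\<rho>' \<le> \<rho>" for \<rho>'
    proof -
      have "\<rho>' * N \<le> \<rho>' * (N + 1)" using that by simp
      also have "\<dots> \<le> \<sigma> * R" using that N0 by (simp add: \<rho>_def pos_le_divide_eq)
      finally have "\<rho>' / \<sigma> * N \<le> R" using \<sigma> by (simp add: pos_divide_le_eq mult.commute)
      moreover have "ps_bounded a \<rho>' (\<rho>' / \<sigma> * N) (\<lambda>x. G x $ j - G a $ j)"
        using that by (intro ps_bounded_vanishing[OF N]) (auto simp: \<rho>_def)
      ultimately show ?thesis by (rule ps_bounded_mono[rotated])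
    qed
    moreover have "0 < \<rho>" using \<sigma> N0 R0 by (simp add: \<rho>_def)
    ultimately show ?thesis by blast
  qed
  then obtain \<rho> where \<rho>: "\<And>j. 0 < \<rho> j"
    "\<And>j \<rho>'. 0 < \<rho>' \<Longrightarrow> \<rho>' \<le> \<rho> j \<Longrightarrow> ps_bounded a \<rho>' R (\<lambda>x. G x $ j - G a $ j)" by metis
  have "0 < Min (range \<rho>)" using \<rho>(1) by simp
  moreover have "ps_bounded a (Min (range \<rho>)) R (\<lambda>x. G x $ j - G a $ j)" for j
    using calculation by (intro \<rho>(2)) auto
  ultimately show ?thesis
    unfolding analytic_pt_iff_ps_bounded using ps_bounded_compose[OF R] by blast
qed

lemma analytic_pt_eventually:
  assumes "analytic_pt \<phi> a"
  shows "\<forall>\<^sub>F y in nhds a. analytic_pt \<phi> y"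
proof -
  obtain \<rho> M where M: "ps_bounded a \<rho> M \<phi>"
    using assms unfolding analytic_pt_iff_ps_bounded by blast
  have "\<forall>\<^sub>F y in nhds a. y \<in> polydisc a (\<rho> / 2)"
    using ps_bounded_pos[OF M] by (intro eventually_polydisc) simp
  then show ?thesis
    unfolding analytic_pt_iff_ps_bounded by (rule eventually_mono) (use ps_bounded_recenter[OF M] in blast)
qed

lemma analytic_pt_cong:
  assumes "\<forall>\<^sub>F x in nhds a. \<phi> x = \<psi> x" "analytic_pt \<phi> a"
  shows "analytic_pt \<psi> a"
proof -
  obtain r c where r: "r > 0" and \<phi>: "\<And>x. x \<in> ball a r \<Longrightarrow>
      (\<lambda>\<alpha>. norm (c \<alpha> * monom \<alpha> (x - a))) summable_on UNIV \<and>
      ((\<lambda>\<alpha>. c \<alpha> * monom \<alpha> (x - a)) has_sum \<phi> x) UNIV"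
    using assms(2) unfolding analytic_pt_def by blast
  obtain d where d: "d > 0" "\<And>x. dist x a < d \<Longrightarrow> \<phi> x = \<psi> x"
    using assms(1) by (auto simp: eventually_nhds_metric)
  show ?thesis
    unfolding analytic_pt_def
  proof (intro exI conjI ballI)
    show "0 < min r d" using r d by simp
    fix x assume "x \<in> ball a (min r d)"
    then show "(\<lambda>\<alpha>. norm (c \<alpha> * monom \<alpha> (x - a))) summable_on UNIV"
      "((\<lambda>\<alpha>. c \<alpha> * monom \<alpha> (x - a)) has_sum \<psi> x) UNIV"
      using \<phi>[of x] d(2)[of x] by (auto simp: dist_commute)
  qed
qed

section \<open>First-order expansion and division by a coordinate\<close>

lemma deg_le_1:
  assumes "deg \<alpha> < 2"
  shows "\<alpha> = (\<lambda>_. 0) \<or> (\<exists>k. \<alpha> = (\<lambda>j. if j = k then 1 else 0))"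
proof (cases "\<alpha> = (\<lambda>_. 0)")
  case False
  then obtain k where k: "\<alpha> k > 0" by (auto simp: fun_eq_iff)
  have "deg \<alpha> = \<alpha> k + sum \<alpha> (UNIV - {k})" by (simp add: sum.remove)
  then have "\<alpha> k = 1" "sum \<alpha> (UNIV - {k}) = 0" using assms k by linarith+
  then have "\<alpha> = (\<lambda>j. if j = k then 1 else 0)" by (auto simp: fun_eq_iff)
  then show ?thesis by blast
qed simp

text \<open>The linear part of the series is the derivative, since the terms of degree at least 2
  sum to O(|x - a|^2). The explicit sum records linearity over \<open>'k\<close>, whereas a Frechet
  derivative is only real-linear.\<close>

lemma analytic_pt_has_derivative:
  assumes "analytic_pt \<phi> a"
  shows "\<exists>d. (\<phi> has_derivative (\<lambda>v. \<Sum>k\<in>UNIV. d k * v $ k)) (at a)"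
proof -
  obtain \<rho> M where "ps_bounded a \<rho> M \<phi>"
    using assms unfolding analytic_pt_iff_ps_bounded by blast
  then obtain c N where \<rho>: "0 < \<rho>" and N: "((\<lambda>\<alpha>. norm (c \<alpha>) * \<rho> ^ deg \<alpha>) has_sum N) UNIV"
    and \<phi>: "\<And>x. x \<in> polydisc a \<rho> \<Longrightarrow> ((\<lambda>\<alpha>. c \<alpha> * monom \<alpha> (x - a)) has_sum \<phi> x) UNIV"
    by (rule ps_boundedE) blast
  \<comment> \<open>Unit exponents: \<open>E\<close> consists of the exponents of degree at most 1,
    and \<open>c (e k)\<close> will be the k-th partial derivative.\<close>
  define e where "e k = (\<lambda>j. if j = k then 1 else 0 :: nat)" for k :: 'b
  have inj: "inj e" by (rule injI) (metis e_def zero_neq_one)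
  have e0: "(\<lambda>_. 0) \<notin> range e" by (metis (mono_tags) e_def imageE zero_neq_one)
  define E where "E = insert (\<lambda>_. 0) (range e)"
  have fin: "finite E" by (simp add: E_def)
  define L where "L v = (\<Sum>k\<in>UNIV. c (e k) * v $ k)" for v
  have sumE: "(\<Sum>\<alpha>\<in>E. c \<alpha> * monom \<alpha> v) = c (\<lambda>_. 0) + L v" for v
    using e0 by (simp add: E_def L_def sum.reindex[OF inj])
      (simp add: e_def)
  have "((\<lambda>\<alpha>. c \<alpha> * monom \<alpha> (a - a)) has_sum c (\<lambda>_. 0)) UNIV"
    by (rule has_sum_finite_neutralI[of "{\<lambda>_. 0}"]) (auto simp: monom_zero_vec)
  moreover have "((\<lambda>\<alpha>. c \<alpha> * monom \<alpha> (a - a)) has_sum \<phi> a) UNIV"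
    using \<rho> by (intro \<phi>) (simp add: polydisc_def)
  ultimately have c0: "c (\<lambda>_. 0) = \<phi> a" using has_sum_unique by metis
  have bound: "norm (\<phi> x - \<phi> a - L (x - a)) \<le> (norm (x - a) / \<rho>)\<^sup>2 * N" if x: "x \<in> ball a \<rho>" for x
  proof -
    define t where "t = norm (x - a)"
    have t: "0 \<le> t" "t \<le> \<rho>" using x by (auto simp: t_def dist_norm norm_minus_commute)
    have "((\<lambda>\<alpha>. c \<alpha> * monom \<alpha> (x - a)) has_sum \<phi> x - (c (\<lambda>_. 0) + L (x - a))) (UNIV - E)"
      using x ball_subset_polydisc[of a \<rho>] sumE[of "x - a"] fin
      by (intro has_sum_Diff \<phi> has_sum_finiteI) auto
    then have rest: "((\<lambda>\<alpha>. c \<alpha> * monom \<alpha> (x - a)) has_sum \<phi> x - \<phi> a - L (x - a)) (UNIV - E)"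
      by (simp add: c0 diff_diff_eq)
    \<comment> \<open>Two powers of t / \<rho> are split off; the remaining powers of t are bounded
      by those of \<rho>.\<close>
    have le: "norm (c \<alpha> * monom \<alpha> (x - a)) \<le> (t / \<rho>)\<^sup>2 * (norm (c \<alpha>) * \<rho> ^ deg \<alpha>)"
      if "\<alpha> \<in> UNIV - E" for \<alpha>
    proof -
      have "2 \<le> deg \<alpha>" using that deg_le_1[of \<alpha>] by (force simp: E_def e_def)
      then obtain m where m: "deg \<alpha> = m + 2" by (metis le_add_diff_inverse2)
      have "norm (monom \<alpha> (x - a)) \<le> t ^ deg \<alpha>"
        unfolding t_def by (rule norm_monom_le) (rule Finite_Cartesian_Product.norm_nth_le)
      also have "\<dots> = t ^ m * t\<^sup>2" by (simp add: m power_add power2_eq_square)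
      also have "\<dots> \<le> \<rho> ^ m * t\<^sup>2" using t by (intro mult_right_mono power_mono) auto
      also have "\<dots> = (t / \<rho>)\<^sup>2 * \<rho> ^ deg \<alpha>"
        using \<rho> by (simp add: m power_add power_divide power2_eq_square)
      finally have "norm (c \<alpha>) * norm (monom \<alpha> (x - a)) \<le> norm (c \<alpha>) * ((t / \<rho>)\<^sup>2 * \<rho> ^ deg \<alpha>)"
        by (rule mult_left_mono) simp
      then show ?thesis by (simp add: norm_mult mult_ac)
    qed
    have N': "((\<lambda>\<alpha>. (t / \<rho>)\<^sup>2 * (norm (c \<alpha>) * \<rho> ^ deg \<alpha>)) has_sum (t / \<rho>)\<^sup>2 * N) UNIV"
      by (rule has_sum_cmult_right[OF N])
    then have s': "(\<lambda>\<alpha>. (t / \<rho>)\<^sup>2 * (norm (c \<alpha>) * \<rho> ^ deg \<alpha>)) summable_on (UNIV - E)"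
      by (rule summable_on_subset_banach[OF has_sum_imp_summable]) simp
    have s: "(\<lambda>\<alpha>. norm (c \<alpha> * monom \<alpha> (x - a))) summable_on (UNIV - E)"
      by (rule summable_on_comparison_test[OF s' le]) auto
    have "norm (\<phi> x - \<phi> a - L (x - a)) \<le> infsum (\<lambda>\<alpha>. norm (c \<alpha> * monom \<alpha> (x - a))) (UNIV - E)"
      by (rule norm_has_sum_bound[OF has_sum_infsum[OF s] rest])
    also have "\<dots> \<le> (t / \<rho>)\<^sup>2 * N"
      by (rule has_sum_mono_neutral[OF has_sum_infsum[OF s] N']) (use le \<rho> in auto)
    finally show ?thesis by (simp add: t_def)
  qed
  have "(\<phi> has_derivative L) (at a)"
    unfolding has_derivative_iff_norm
  proof
    show "bounded_linear L"
      unfolding L_def by (intro bounded_linear_sum bounded_linear_const_mult bounded_linear_vec_nth)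
    have "\<forall>\<^sub>F x in at a. norm (norm (\<phi> x - \<phi> a - L (x - a)) / norm (x - a)) \<le> norm (x - a) * (N / \<rho>\<^sup>2)"
      unfolding eventually_at
    proof (intro exI conjI ballI impI)
      fix x assume "x \<noteq> a \<and> dist x a < \<rho>"
      then have "x \<in> ball a \<rho>" "norm (x - a) > 0" by (auto simp: dist_commute)
      with bound[of x] show "norm (norm (\<phi> x - \<phi> a - L (x - a)) / norm (x - a)) \<le> norm (x - a) * (N / \<rho>\<^sup>2)"
        by (simp add: divide_le_eq power_divide power2_eq_square mult_ac)
    qed (rule \<rho>)
    moreover have "((\<lambda>x. norm (x - a) * (N / \<rho>\<^sup>2)) \<longlongrightarrow> norm (a - a) * (N / \<rho>\<^sup>2)) (at a)"
      by (intro tendsto_intros)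
    then have "((\<lambda>x. norm (x - a) * (N / \<rho>\<^sup>2)) \<longlongrightarrow> 0) (at a)" by simp
    ultimately show "((\<lambda>x. norm (\<phi> x - \<phi> a - L (x - a)) / norm (x - a)) \<longlongrightarrow> 0) (at a)"
      by (rule Lim_null_comparison)
  qed
  then show ?thesis unfolding L_def by (rule exI[of _ "\<lambda>k. c (e k)"])
qed

text \<open>Setting x_k = 0 shows that the terms free of x_k sum to zero. Every other term contains
  x_k, and G is the series with one such factor removed.\<close>

lemma analytic_pt_divide_coord:
  assumes \<phi>: "analytic_pt \<phi> a" and ak: "a $ k = 0"
    and van: "\<forall>\<^sub>F x in nhds a. x $ k = 0 \<longrightarrow> \<phi> x = 0"
  shows "\<exists>G. analytic_pt G a \<and> (\<forall>\<^sub>F x in nhds a. \<phi> x = x $ k * G x)"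
proof -
  obtain \<sigma> M where M: "ps_bounded a \<sigma> M \<phi>"
    using \<phi> unfolding analytic_pt_iff_ps_bounded by blast
  obtain r where r: "r > 0" "\<And>x. dist x a < r \<Longrightarrow> x $ k = 0 \<Longrightarrow> \<phi> x = 0"
    using van by (auto simp: eventually_nhds_metric)
  \<comment> \<open>Small enough for convergence and for the polydisc to lie in the ball where
    \<phi> vanishes along x_k = 0.\<close>
  define \<rho> where "\<rho> = min \<sigma> (r / (2 * real CARD('b)))"
  have "0 < \<rho>" using r ps_bounded_pos[OF M] by (simp add: \<rho>_def)
  then have "ps_bounded a \<rho> M \<phi>" by (rule ps_bounded_shrink[OF M]) (simp add: \<rho>_def)
  then obtain c N where \<rho>: "0 < \<rho>" and N: "((\<lambda>\<alpha>. norm (c \<alpha>) * \<rho> ^ deg \<alpha>) has_sum N) UNIV"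
    and \<phi>: "\<And>x. x \<in> polydisc a \<rho> \<Longrightarrow> ((\<lambda>\<alpha>. c \<alpha> * monom \<alpha> (x - a)) has_sum \<phi> x) UNIV"
    by (rule ps_boundedE) blast
  have "polydisc a \<rho> \<subseteq> polydisc a (r / (2 * real CARD('b)))"
    by (auto simp: polydisc_def \<rho>_def intro: order_trans)
  then have van': "\<phi> x = 0" if "x \<in> polydisc a \<rho>" "x $ k = 0" for x
    using that polydisc_subset_ball[OF r(1), of a] r(2)[of x] by (force simp: dist_commute)
  \<comment> \<open>Raising the k-th entry by one is a bijection from all exponents onto those with
    positive k-th entry.\<close>
  define e where "e \<alpha> = (\<lambda>j. \<alpha> j + (if j = k then 1 else 0 :: nat))" for \<alpha> :: "'b \<Rightarrow> nat"
  have inj: "inj e" by (rule injI) (simp add: e_def fun_eq_iff)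
  have range_e: "\<alpha> \<in> range e \<longleftrightarrow> \<alpha> k \<noteq> 0" for \<alpha>
  proof
    assume "\<alpha> k \<noteq> 0"
    then have "\<alpha> = e (\<alpha>(k := \<alpha> k - 1))" by (auto simp: e_def fun_eq_iff)
    then show "\<alpha> \<in> range e" by blast
  qed (auto simp: e_def)
  have deg_e: "deg (e \<alpha>) = deg \<alpha> + 1" for \<alpha> by (simp add: e_def sum.distrib)
  have monom_e: "monom (e \<alpha>) v = v $ k * monom \<alpha> v" for \<alpha> v
    unfolding e_def monom_mult by simp
  have "(\<lambda>\<alpha>. norm (c \<alpha>) * \<rho> ^ deg \<alpha>) summable_on range e"
    using N by (rule summable_on_subset_banach[OF has_sum_imp_summable]) simp
  then have "(\<lambda>\<alpha>. norm (c (e \<alpha>)) * \<rho> ^ deg \<alpha> * \<rho>) summable_on UNIV"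
    unfolding summable_on_reindex[OF inj] o_def deg_e by (simp add: mult_ac)
  then have s: "(\<lambda>\<alpha>. norm (c (e \<alpha>)) * \<rho> ^ deg \<alpha>) summable_on UNIV"
    using \<rho> by (simp only: summable_on_cmult_left'[of \<rho>])
  define G where "G x = infsum (\<lambda>\<alpha>. c (e \<alpha>) * monom \<alpha> (x - a)) UNIV" for x
  have G: "((\<lambda>\<alpha>. c (e \<alpha>) * monom \<alpha> (x - a)) has_sum G x) UNIV" if "x \<in> polydisc a \<rho>" for x
    unfolding G_def
    by (rule has_sum_infsum, rule norm_summable_imp_summable, rule summable_on_comparison_test[OF s])
      (rule norm_term_le[OF that] norm_ge_zero)+
  have "ps_bounded a \<rho> (infsum (\<lambda>\<alpha>. norm (c (e \<alpha>)) * \<rho> ^ deg \<alpha>) UNIV) G"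
    unfolding ps_bounded_def using \<rho> G has_sum_infsum[OF s] by (intro conjI exI ballI) auto
  moreover have "\<phi> x = x $ k * G x" if x: "x \<in> polydisc a \<rho>" for x
  proof -
    \<comment> \<open>The projection of x to the hyperplane keeps exactly the terms with \<alpha> k
      = 0, and \<phi> vanishes there. Subtracting its expansion from that of x leaves the sum over
      \<open>range e\<close>.\<close>
    define y where "y = (\<chi> i. if i = k then 0 else x $ i)"
    have y: "y \<in> polydisc a \<rho>" using x \<rho> ak by (auto simp: polydisc_def y_def)
    have "monom \<alpha> (y - a) = (if \<alpha> k = 0 then monom \<alpha> (x - a) else 0)" for \<alpha>
    proof (cases "\<alpha> k = 0")
      case True
      then show ?thesis unfolding monom_def
        by (auto simp: y_def intro!: prod.cong)
    next
      case False
      then have "monom \<alpha> (y - a) = 0"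
        unfolding monom_def by (intro prod_zero) (auto simp: y_def ak intro!: bexI[of _ k])
      with False show ?thesis by simp
    qed
    then have "((\<lambda>\<alpha>. c \<alpha> * (if \<alpha> k = 0 then monom \<alpha> (x - a) else 0)) has_sum 0) UNIV"
      using \<phi>[OF y] van'[OF y] by (simp add: y_def)
    from has_sum_add[OF \<phi>[OF x] has_sum_uminusI[OF this]]
    have "((\<lambda>\<alpha>. c \<alpha> * monom \<alpha> (x - a) - c \<alpha> * (if \<alpha> k = 0 then monom \<alpha> (x - a) else 0)) has_sum \<phi> x) UNIV"
      by simp
    then have "((\<lambda>\<alpha>. c \<alpha> * monom \<alpha> (x - a)) has_sum \<phi> x) (range e)"
      by (rule has_sum_cong_neutral[THEN iffD1, rotated 3]) (auto simp: range_e)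
    then have "((\<lambda>\<alpha>. (x - a) $ k * (c (e \<alpha>) * monom \<alpha> (x - a))) has_sum \<phi> x) UNIV"
      unfolding has_sum_reindex[OF inj] o_def monom_e by (simp add: mult_ac)
    from has_sum_unique[OF this has_sum_cmult_right[OF G[OF x]]] show ?thesis by (simp add: ak)
  qed
  then have "\<forall>\<^sub>F x in nhds a. \<phi> x = x $ k * G x"
    by (rule eventually_mono[OF eventually_polydisc[OF \<rho>]])
  ultimately show ?thesis unfolding analytic_pt_iff_ps_bounded by blast
qed

subsection \<open>Derivatives and germs of analytic maps\<close>

text \<open>Neighbourhoods of the single points unite to one of \<open>A\<close>, so statements
  about multigerms reduce to points.\<close>

lemma near_iff_eventually: "near A P \<longleftrightarrow> (\<forall>a\<in>A. \<forall>\<^sub>F x in nhds a. P x)"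
proof
  assume "\<forall>a\<in>A. \<forall>\<^sub>F x in nhds a. P x"
  then obtain U where "\<And>a. a \<in> A \<Longrightarrow> open (U a) \<and> a \<in> U a \<and> (\<forall>x\<in>U a. P x)"
    unfolding eventually_nhds by metis
  then show "near A P"
    unfolding near_def by (intro exI[of _ "\<Union>a\<in>A. U a"]) auto
qed (auto simp: near_def eventually_nhds)

text \<open>Analyticity is an open condition by recentring.\<close>

lemma an_fun_iff: "an_fun A \<phi> \<longleftrightarrow> (\<forall>a\<in>A. analytic_pt \<phi> a)"
  unfolding an_fun_def near_iff_eventually
  using analytic_pt_eventually eventually_nhds_x_imp_x by blast

lemma an_map_iff: "an_map A h \<longleftrightarrow> (\<forall>a\<in>A. \<forall>j. analytic_pt (\<lambda>x. h x $ j) a)"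
  unfolding an_map_def near_iff_eventually
proof (intro ball_cong refl iffI)
  fix a assume "\<forall>j. analytic_pt (\<lambda>x. h x $ j) a"
  then show "\<forall>\<^sub>F x in nhds a. \<forall>j. analytic_pt (\<lambda>y. h y $ j) x"
    by (intro eventually_all_finite analytic_pt_eventually) auto
qed (rule eventually_nhds_x_imp_x)

section \<open>Componentwise calculus and partial derivatives\<close>

lemma bounded_linear_axis: "bounded_linear (axis i :: 'k::real_normed_vector \<Rightarrow> 'k ^ 'n::finite)"
proof (rule bounded_linear_intro[where K = 1])
  fix x y :: 'k and r :: real
  show "axis i (x + y) = axis i x + axis i y" "axis i (r *\<^sub>R x) = r *\<^sub>R axis i x"
    by (simp_all add: vec_eq_iff axis_def)
  have "norm (axis i x) \<le> (\<Sum>j\<in>UNIV. norm (axis i x $ j))"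
    unfolding norm_vec_def by (rule L2_set_le_sum) simp
  also have "\<dots> = (\<Sum>j\<in>UNIV. if j = i then norm x else 0)"
    by (intro sum.cong) (auto simp: axis_def)
  finally show "norm (axis i x) \<le> norm x * 1" by simp
qed

lemma vec_eq_sum_axis: "x = (\<Sum>i\<in>UNIV. axis i (x $ i))"
  by (simp add: vec_eq_iff axis_def if_distrib cong: if_cong)

lemma bounded_linear_componentwise:
  fixes f :: "'v::real_normed_vector \<Rightarrow> 'k::real_normed_vector ^ 'n::finite"
  assumes "\<And>i. bounded_linear (\<lambda>x. f x $ i)"
  shows "bounded_linear f"
proof -
  have "bounded_linear (\<lambda>x. \<Sum>i\<in>UNIV. axis i (f x $ i))"
    by (intro bounded_linear_sum bounded_linear_compose[OF bounded_linear_axis] assms)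
  then show ?thesis by (simp flip: vec_eq_sum_axis)
qed

lemma has_derivative_componentwise_vec:
  fixes f :: "'v::real_normed_vector \<Rightarrow> 'k::real_normed_vector ^ 'n::finite"
  assumes "\<And>i. ((\<lambda>x. f x $ i) has_derivative (\<lambda>v. f' v $ i)) F"
  shows "(f has_derivative f') F"
proof -
  have "((\<lambda>x. \<Sum>i\<in>UNIV. axis i (f x $ i)) has_derivative (\<lambda>v. \<Sum>i\<in>UNIV. axis i (f' v $ i))) F"
    by (intro has_derivative_sum bounded_linear.has_derivative[OF bounded_linear_axis] assms)
  then show ?thesis by (simp flip: vec_eq_sum_axis)
qed

lemma eventually_nhds_compose:
  assumes "isCont g a" "\<forall>\<^sub>F y in nhds (g a). P y"
  shows "\<forall>\<^sub>F x in nhds a. P (g x)"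
  using assms by (simp add: isCont_def tendsto_at_iff_tendsto_nhds eventually_compose_filterlim)

definition pderiv_at :: "'a::finite \<Rightarrow> ('k::real_normed_field ^ 'a \<Rightarrow> 'k) \<Rightarrow> 'k ^ 'a \<Rightarrow> 'k" where
  "pderiv_at k \<phi> x = frechet_derivative \<phi> (at x) (axis k 1)"

lemma analytic_pt_has_pderiv:
  assumes "analytic_pt \<phi> a"
  shows "(\<phi> has_derivative (\<lambda>v. \<Sum>k\<in>UNIV. pderiv_at k \<phi> a * v $ k)) (at a)"
proof -
  obtain d where d: "(\<phi> has_derivative (\<lambda>v. \<Sum>k\<in>UNIV. d k * v $ k)) (at a)"
    using analytic_pt_has_derivative[OF assms] by blast
  have "pderiv_at k \<phi> a = d k" for k
    unfolding pderiv_at_def frechet_derivative_at[OF d, symmetric]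
    by (simp add: axis_def if_distrib cong: if_cong)
  with d show ?thesis by simp
qed

text \<open>The product rule on the hyperplane x_k = 0. It determines the quotient G exactly where
  dividing by x_k says nothing.\<close>

lemma pderiv_at_coord_mult:
  assumes G: "analytic_pt G a" and ak: "a $ k = 0" and eq: "\<forall>\<^sub>F x in nhds a. \<phi> x = x $ k * G x"
  shows "pderiv_at k \<phi> a = G a"
proof -
  define L where "L v = (\<Sum>j\<in>UNIV. pderiv_at j G a * v $ j)" for v
  have "((\<lambda>x. x $ k * G x) has_derivative (\<lambda>v. a $ k * L v + v $ k * G a)) (at a)"
    unfolding L_def
    by (intro has_derivative_mult bounded_linear_imp_has_derivative bounded_linear_vec_nth
        analytic_pt_has_pderiv[OF G])
  moreover have "\<forall>\<^sub>F x in at a. x $ k * G x = \<phi> x"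
    using eq unfolding eventually_at_filter by eventually_elim simp
  moreover have "a $ k * G a = \<phi> a" using eventually_nhds_x_imp_x[OF eq] by simp
  ultimately have "(\<phi> has_derivative (\<lambda>v. a $ k * L v + v $ k * G a)) (at a)"
    by (rule has_derivative_transform_eventually) simp
  from fun_cong[OF frechet_derivative_at[OF this], of "axis k 1"] show ?thesis
    by (simp add: pderiv_at_def ak)
qed

lemma an_fun_divide_coord:
  assumes \<phi>: "an_fun A \<phi>" and A: "\<And>a. a \<in> A \<Longrightarrow> a $ k = 0"
    and van: "\<And>a. a \<in> A \<Longrightarrow> \<forall>\<^sub>F x in nhds a. x $ k = 0 \<longrightarrow> \<phi> x = 0"
  shows "\<exists>\<psi>. an_fun A \<psi> \<and> near A (\<lambda>x. \<phi> x = x $ k * \<psi> x)"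
proof -
  \<comment> \<open>The local quotients G depend on the point a. This single formula agrees with
    each of them nearby, so they glue to one function on a neighbourhood of
    \<open>A\<close>.\<close>
  define \<psi> where "\<psi> x = (if x $ k = 0 then pderiv_at k \<phi> x else \<phi> x / x $ k)" for x
  have "analytic_pt \<psi> a \<and> (\<forall>\<^sub>F x in nhds a. \<phi> x = x $ k * \<psi> x)" if a: "a \<in> A" for a
  proof -
    obtain G where G: "analytic_pt G a" "\<forall>\<^sub>F x in nhds a. \<phi> x = x $ k * G x"
      using analytic_pt_divide_coord[OF _ A van] \<phi> a unfolding an_fun_iff by metis
    \<comment> \<open>The partial derivative at y depends on \<phi> around y, so the factorisation
      must hold near each y close to a.\<close>
    have "\<forall>\<^sub>F y in nhds a. \<forall>\<^sub>F x in nhds y. \<phi> x = x $ k * G x"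
      using G(2) by (simp add: eventually_eventually)
    with analytic_pt_eventually[OF G(1)] have "\<forall>\<^sub>F y in nhds a. G y = \<psi> y"
    proof eventually_elim
      case (elim y)
      then show ?case
        using pderiv_at_coord_mult[OF elim(1) _ elim(2)] eventually_nhds_x_imp_x[OF elim(2)]
        by (auto simp: \<psi>_def)
    qed
    then have "analytic_pt \<psi> a" using G(1) by (rule analytic_pt_cong)
    moreover from \<open>\<forall>\<^sub>F y in nhds a. G y = \<psi> y\<close> G(2)
    have "\<forall>\<^sub>F x in nhds a. \<phi> x = x $ k * \<psi> x" by eventually_elim simp
    ultimately show ?thesis by blast
  qed
  then show ?thesis unfolding an_fun_iff near_iff_eventually by blast
qed

section \<open>Base and parameter coordinates\<close>

definition base :: "'k ^ ('a::finite + 'r::finite) \<Rightarrow> 'k ^ 'a" where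
  "base z = (\<chi> i. z $ Inl i)"

lemma pt_nth [simp]: "pt x l $ Inl i = x $ i" "pt x l $ Inr j = l $ j"
  by (simp_all add: pt_def)

lemma base_nth [simp]: "base z $ i = z $ Inl i"
  by (simp add: base_def)

lemma base_pt [simp]: "base (pt x l) = x"
  by (simp add: vec_eq_iff)

lemma vec_sum_eqI:
  assumes "\<And>i. x $ Inl i = y $ Inl i" "\<And>j. x $ Inr j = y $ Inr j"
  shows "x = y"
  unfolding vec_eq_iff using assms by (metis sum.exhaust)

lemma pt_0_0 [simp]: "pt 0 0 = 0" and base_0 [simp]: "base 0 = 0"
  by (rule vec_sum_eqI; simp) (simp add: vec_eq_iff)

lemma bounded_linear_pt0: "bounded_linear (\<lambda>x::'k::real_normed_field ^ 'a::finite. pt x (0 :: 'k ^ 'r::finite))"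
proof (rule bounded_linear_componentwise)
  fix i :: "'a + 'r"
  show "bounded_linear (\<lambda>x. pt x (0 :: 'k ^ 'r) $ i)"
    by (cases i) (auto simp: bounded_linear_vec_nth bounded_linear_zero)
qed

lemma bounded_linear_base: "bounded_linear (base :: 'k::real_normed_field ^ ('a::finite + 'r::finite) \<Rightarrow> _)"
  by (rule bounded_linear_componentwise) (simp add: bounded_linear_vec_nth)

lemma isCont_pt0: "isCont (\<lambda>x::'k::real_normed_field ^ 'a::finite. pt x (0 :: 'k ^ 'r::finite)) a"
  by (rule linear_continuous_at[OF bounded_linear_pt0])

lemma isCont_base: "isCont (base :: 'k::real_normed_field ^ ('a::finite + 'r::finite) \<Rightarrow> _) a"
  by (rule linear_continuous_at[OF bounded_linear_base])

lemma analytic_pt_pt0_nth: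
  "analytic_pt (\<lambda>x::'k::real_normed_field ^ 'a::finite. pt x (0 :: 'k ^ 'r::finite) $ i) a"
  by (cases i) auto

lemma analytic_pt_restrict:
  fixes \<phi> :: "'k::real_normed_field ^ ('a::finite + 'r::finite) \<Rightarrow> 'k"
  shows "analytic_pt \<phi> (pt a 0) \<Longrightarrow> analytic_pt (\<lambda>x. \<phi> (pt x 0)) a"
  by (rule analytic_pt_compose) (auto intro: analytic_pt_pt0_nth)

lemma analytic_pt_extend:
  fixes \<phi> :: "'k::real_normed_field ^ 'a::finite \<Rightarrow> 'k" and z :: "'k ^ ('a + 'r::finite)"
  shows "analytic_pt \<phi> (base z) \<Longrightarrow> analytic_pt (\<lambda>z. \<phi> (base z)) z"
  by (rule analytic_pt_compose) auto

text \<open>The difference quotient \<open>(\<phi>(x + t e\<^sub>k) - \<phi>(x)) / t\<close> is analytic in \<open>(x, t)\<close> by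
  \<open>analytic_pt_divide_coord\<close>, and the partial derivative is its value at \<open>t = 0\<close>.\<close>
lemma analytic_pt_pderiv:
  fixes \<phi> :: "'k::real_normed_field ^ 'a::finite \<Rightarrow> 'k"
  assumes \<phi>: "analytic_pt \<phi> a"
  shows "analytic_pt (pderiv_at k \<phi>) a"
proof -
  \<comment> \<open>The extra index of \<open>'a + unit\<close> is the increment t, so P(x, t) = x +
    t e_k.\<close>
  define P where "P z = (\<chi> i. z $ Inl i + (if i = k then z $ Inr () else 0))"
    for z :: "'k ^ ('a + unit)"
  define \<Phi> where "\<Phi> z = \<phi> (P z) - \<phi> (base z)" for z
  have P0: "P z = base z" if "z $ Inr () = 0" for z using that by (simp add: P_def vec_eq_iff)
  have Pa: "P (pt x 0) = x" for x by (simp add: P0)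
  have P: "analytic_pt (\<lambda>z. P z $ i) z" for i z
    unfolding P_def by (cases "i = k") (auto intro!: analytic_pt_add)
  have blP: "bounded_linear P"
  proof (rule bounded_linear_componentwise)
    show "bounded_linear (\<lambda>z. P z $ i)" for i
      by (cases "i = k") (auto simp: P_def bounded_linear_vec_nth intro!: bounded_linear_add)
  qed
  have "analytic_pt (\<lambda>z. \<phi> (P z)) (pt a 0)"
    by (rule analytic_pt_compose) (simp_all add: Pa \<phi> P)
  then have "analytic_pt \<Phi> (pt a 0)"
    unfolding \<Phi>_def by (intro analytic_pt_diff analytic_pt_extend) (simp_all add: \<phi>)
  moreover have "\<forall>\<^sub>F z in nhds (pt a 0). z $ Inr () = 0 \<longrightarrow> \<Phi> z = 0"
    by (simp add: \<Phi>_def P0)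
  ultimately obtain G where G: "analytic_pt G (pt a 0)"
    "\<forall>\<^sub>F z in nhds (pt a 0). \<Phi> z = z $ Inr () * G z"
    using analytic_pt_divide_coord[of \<Phi> "pt a 0" "Inr ()"] by auto
  have "\<forall>\<^sub>F w in nhds (pt a 0). \<forall>\<^sub>F z in nhds w. \<Phi> z = z $ Inr () * G z"
    using G(2) by (simp add: eventually_eventually)
  from eventually_nhds_compose[OF isCont_pt0 this]
    eventually_nhds_compose[OF isCont_pt0 analytic_pt_eventually[OF G(1)]]
    analytic_pt_eventually[OF \<phi>]
  have "\<forall>\<^sub>F y in nhds a. G (pt y 0) = pderiv_at k \<phi> y"
  proof eventually_elim
    case (elim y)
    define D where "D v = (\<Sum>j\<in>UNIV. pderiv_at j \<phi> y * v $ j)" for v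
    have D: "(\<phi> has_derivative D) (at y)"
      unfolding D_def by (rule analytic_pt_has_pderiv[OF elim(3)])
    have "((\<lambda>z. \<phi> (P z)) has_derivative (\<lambda>v. D (P v))) (at (pt y 0))"
      by (rule has_derivative_compose[OF bounded_linear_imp_has_derivative[OF blP]])
        (simp add: Pa D)
    moreover have "((\<lambda>z. \<phi> (base z)) has_derivative (\<lambda>v. D (base v))) (at (pt y 0))"
      by (rule has_derivative_compose[OF bounded_linear_imp_has_derivative[OF bounded_linear_base]])
        (simp add: D)
    ultimately have "(\<Phi> has_derivative (\<lambda>v. D (P v) - D (base v))) (at (pt y 0))"
      unfolding \<Phi>_def by (rule has_derivative_diff)
    \<comment> \<open>In the t-direction \<open>P\<close> moves along e_k while \<open>base\<close>
      stays fixed, so the t-derivative of \<Phi> is the k-th partial derivative of \<phi>.\<close>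
    from frechet_derivative_at[OF this]
    have "pderiv_at (Inr ()) \<Phi> (pt y 0) = D (P (axis (Inr ()) 1)) - D (base (axis (Inr ()) 1))"
      unfolding pderiv_at_def by metis
    also have "P (axis (Inr ()) 1) = axis k 1" by (auto simp: P_def axis_def vec_eq_iff)
    also have "base (axis (Inr ()) 1) = (0 :: 'k ^ 'a)" by (auto simp: axis_def vec_eq_iff)
    also have "D (axis k 1) - D 0 = pderiv_at k \<phi> y"
      by (simp add: D_def axis_def if_distrib cong: if_cong)
    finally show ?case
      using pderiv_at_coord_mult[OF elim(2) _ elim(1)] by simp
  qed
  then show ?thesis by (rule analytic_pt_cong) (rule analytic_pt_restrict[OF G(1)])
qed

lemma has_derivative_analytic_map:
  assumes "\<And>j. analytic_pt (\<lambda>y. h y $ j) x"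
  shows "(h has_derivative (\<lambda>v. \<chi> j. \<Sum>k\<in>UNIV. pderiv_at k (\<lambda>y. h y $ j) x * v $ k)) (at x)"
  by (rule has_derivative_componentwise_vec) (simp add: analytic_pt_has_pderiv assms)

lemma frechet_derivative_analytic_map:
  assumes "\<And>j. analytic_pt (\<lambda>y. h y $ j) x"
  shows "frechet_derivative h (at x) v $ j = (\<Sum>k\<in>UNIV. pderiv_at k (\<lambda>y. h y $ j) x * v $ k)"
  by (simp flip: frechet_derivative_at[OF has_derivative_analytic_map[OF assms]])

text \<open>Near \<open>A\<close> each component is a finite sum of products of partial derivatives
  of h with components of \<xi>.\<close>

lemma an_map_dcomp:
  assumes h: "an_map A h" and \<xi>: "an_map A \<xi>"
  shows "an_map A (dcomp h \<xi>)"
  unfolding an_map_iff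
proof (intro ballI allI)
  fix a j assume a: "a \<in> A"
  have "\<forall>\<^sub>F x in nhds a. \<forall>j. analytic_pt (\<lambda>y. h y $ j) x"
    using h a unfolding an_map_def near_iff_eventually by blast
  then have "\<forall>\<^sub>F x in nhds a. (\<Sum>k\<in>UNIV. pderiv_at k (\<lambda>y. h y $ j) x * \<xi> x $ k) = dcomp h \<xi> x $ j"
    by eventually_elim (simp add: dcomp_def frechet_derivative_analytic_map)
  moreover have "analytic_pt (\<lambda>x. \<Sum>k\<in>UNIV. pderiv_at k (\<lambda>y. h y $ j) x * \<xi> x $ k) a"
    using h \<xi> a unfolding an_map_iff
    by (intro analytic_pt_sum analytic_pt_mult analytic_pt_pderiv) auto
  ultimately show "analytic_pt (\<lambda>x. dcomp h \<xi> x $ j) a" by (rule analytic_pt_cong)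
qed

lemma analytic_map_isCont:
  assumes "\<And>j. analytic_pt (\<lambda>y. h y $ j) x"
  shows "isCont h x"
  using has_derivative_continuous[OF has_derivative_analytic_map[OF assms]] .

subsection \<open>Liftable vector fields\<close>

lemma eq_pt_base: "z $ Inr () = 0 \<Longrightarrow> z = pt (base z) 0"
  for z :: "'k::real_normed_field ^ ('a::finite + unit)"
  by (rule vec_sum_eqI) auto

lemma gsq_has_derivative:
  fixes w :: "'k::real_normed_field ^ ('p::finite + 'r::finite)"
  shows "(gsq i has_derivative
    (\<lambda>v. \<chi> k. case k of Inl _ \<Rightarrow> v $ k | Inr j \<Rightarrow> if j = i then 2 * w $ k * v $ k else v $ k)) (at w)"
proof (rule has_derivative_componentwise_vec)
  fix k :: "'p + 'r"
  have nth: "((\<lambda>y. y $ k) has_derivative (\<lambda>v. v $ k)) (at w)"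
    by (rule bounded_linear_imp_has_derivative[OF bounded_linear_vec_nth])
  have "((\<lambda>y. y $ k * y $ k) has_derivative (\<lambda>v. w $ k * v $ k + v $ k * w $ k)) (at w)"
    by (rule has_derivative_mult[OF nth nth])
  then have "((\<lambda>y. (y $ k)\<^sup>2) has_derivative (\<lambda>v. 2 * w $ k * v $ k)) (at w)"
    by (simp add: power2_eq_square mult_ac mult_2)
  with nth show "((\<lambda>y. gsq i y $ k) has_derivative (\<lambda>v. (\<chi> k. case k of Inl _ \<Rightarrow> v $ k
      | Inr j \<Rightarrow> if j = i then 2 * w $ k * v $ k else v $ k) $ k)) (at w)"
    by (cases k; cases "k = Inr i") (simp_all add: gsq_def)
qed

lemma dcomp_gsq:
  "dcomp (gsq i) \<zeta> w = (\<chi> k. case k of Inl _ \<Rightarrow> \<zeta> w $ k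
    | Inr j \<Rightarrow> if j = i then 2 * w $ k * \<zeta> w $ k else \<zeta> w $ k)"
  unfolding dcomp_def by (simp flip: frechet_derivative_at[OF gsq_has_derivative])

text \<open>\<open>gsq j\<close> fixes the points (X, 0), and the factor 2 \<lambda>_j in its
  differential kills the \<lambda>_j-component there.\<close>

lemma liftable_gsq_vanishing:
  fixes \<eta> :: "'k::real_normed_field ^ ('p::finite + 'r::finite) \<Rightarrow> 'k ^ ('p + 'r)"
  assumes "liftable (gsq j) {0} \<eta>"
  shows "\<forall>\<^sub>F X in nhds 0. \<eta> (pt X 0) $ Inr j = 0"
proof -
  obtain \<zeta> where "agree_near {0} (\<eta> \<circ> gsq j) (dcomp (gsq j) \<zeta>)"
    using assms unfolding liftable_def in_TRe_def by blast
  then have "\<forall>\<^sub>F w in nhds (pt 0 0). \<eta> (gsq j w) = dcomp (gsq j) \<zeta> w"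
    by (simp add: agree_near_def near_iff_eventually)
  from eventually_nhds_compose[OF isCont_pt0 this] show ?thesis
  proof eventually_elim
    case (elim X)
    have "gsq j (pt X (0 :: 'k ^ 'r)) = pt X 0"
      by (rule vec_sum_eqI) (simp_all add: gsq_def)
    with elim show ?case by (simp add: dcomp_gsq)
  qed
qed

text \<open>Along \<lambda> = 0 the differential of F is block triangular: base directions are
  mapped by df, and the parameter rows are those of the identity.\<close>

lemma unfolding_along_base:
  fixes F :: "'k::real_normed_field ^ ('n::finite + 'r::finite) \<Rightarrow> 'k ^ ('p::finite + 'r)"
  assumes unf: "unfolding_of f S F" and s: "s \<in> S"
  shows "\<forall>\<^sub>F x in nhds s. F (pt x 0) = pt (f x) 0 \<and>
    (\<forall>v. base (frechet_derivative F (at (pt x 0)) (pt v 0)) = frechet_derivative f (at x) v) \<and>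
    (\<forall>v j. frechet_derivative F (at (pt x 0)) v $ Inr j = v $ Inr j)"
proof -
  have an: "\<forall>\<^sub>F z in nhds (pt s 0). \<forall>j. analytic_pt (\<lambda>y. F y $ j) z"
    and par: "\<forall>\<^sub>F z in nhds (pt s 0). \<forall>j. F z $ Inr j = z $ Inr j"
    and res: "\<forall>\<^sub>F x in nhds s. base (F (pt x 0)) = f x"
    using unf s
    by (auto simp: unfolding_of_def multigerm_def an_map_def near_iff_eventually agree_near_def base_def)
  \<comment> \<open>Differentiating these identities at points near s requires each of them on a
    neighbourhood of such a point.\<close>
  have par': "\<forall>\<^sub>F w in nhds (pt s 0). \<forall>\<^sub>F z in nhds w. \<forall>j. F z $ Inr j = z $ Inr j"
    and res': "\<forall>\<^sub>F y in nhds s. \<forall>\<^sub>F x in nhds y. base (F (pt x 0)) = f x"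
    using par res by (simp_all add: eventually_eventually)
  from eventually_nhds_compose[OF isCont_pt0 an] eventually_nhds_compose[OF isCont_pt0 par'] res'
  show ?thesis
  proof eventually_elim
    case (elim x)
    define D where "D = frechet_derivative F (at (pt x 0))"
    have "F differentiable at (pt x 0)"
      by (rule differentiableI[OF has_derivative_analytic_map[OF elim(1)[rule_format]]])
    then have D: "(F has_derivative D) (at (pt x 0))"
      unfolding frechet_derivative_works D_def .
    have "((\<lambda>y. base (F (pt y 0))) has_derivative (\<lambda>v. base (D (pt v 0)))) (at x)"
      by (rule bounded_linear.has_derivative[OF bounded_linear_base])
        (rule has_derivative_compose[OF bounded_linear_imp_has_derivative[OF bounded_linear_pt0] D])
    then have "(f has_derivative (\<lambda>v. base (D (pt v 0)))) (at x)"
      by (rule has_derivative_transform_eventually)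
        (use elim(3) eventually_nhds_x_imp_x[OF elim(3)] in
          \<open>auto simp: eventually_at_filter elim: eventually_mono\<close>)
    then have base: "base (D (pt v 0)) = frechet_derivative f (at x) v" for v
      by (rule fun_cong[OF frechet_derivative_at])
    have Inr: "D v $ Inr j = v $ Inr j" for v j
    proof -
      have "((\<lambda>z. F z $ Inr j) has_derivative (\<lambda>v. D v $ Inr j)) (at (pt x 0))"
        by (rule bounded_linear.has_derivative[OF bounded_linear_vec_nth D])
      then have "((\<lambda>z. z $ Inr j) has_derivative (\<lambda>v. D v $ Inr j)) (at (pt x 0))"
        by (rule has_derivative_transform_eventually)
          (use elim(2) eventually_nhds_x_imp_x[OF elim(2)] in
            \<open>auto simp: eventually_at_filter elim: eventually_mono\<close>)
      moreover have "((\<lambda>z. z $ Inr j) has_derivative (\<lambda>v. v $ Inr j)) (at (pt x 0))"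
        by (rule bounded_linear_imp_has_derivative[OF bounded_linear_vec_nth])
      ultimately show ?thesis by (rule fun_cong[OF has_derivative_unique])
    qed
    have "F (pt x 0) = pt (f x) 0"
      using eventually_nhds_x_imp_x[OF elim(3)] eventually_nhds_x_imp_x[OF elim(2)]
      by (intro vec_sum_eqI) (auto simp: vec_eq_iff)
    with base Inr show ?case unfolding D_def by blast
  qed
qed

lemma restr_eq_base: "restr \<eta> X = base (\<eta> (pt X 0))"
  by (simp add: restr_def base_def)

lemma liftable_restr:
  fixes F :: "'k::real_normed_field ^ ('n::finite + 'r::finite) \<Rightarrow> 'k ^ ('p::finite + 'r)"
  assumes f: "multigerm S f" and unf: "unfolding_of f S F"
    and lF: "liftable F ((\<lambda>s. pt s 0) ` S) \<eta>" and lg: "\<And>i. liftable (gsq i) {0} \<eta>"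
  shows "liftable f S (restr \<eta>)"
proof -
  obtain \<xi> where \<xi>: "an_map ((\<lambda>s. pt s 0) ` S) \<xi>"
    and eq: "agree_near ((\<lambda>s. pt s 0) ` S) (\<eta> \<circ> F) (dcomp F \<xi>)"
    and \<eta>: "an_map {0} \<eta>"
    using lF unfolding liftable_def in_TRe_def by blast
  have "an_map {0} (restr \<eta>)"
    using \<eta> by (auto simp: an_map_iff restr_eq_base intro: analytic_pt_restrict)
  moreover have "an_map S (\<lambda>x. base (\<xi> (pt x 0)))"
    using \<xi> by (auto simp: an_map_iff intro: analytic_pt_restrict)
  moreover have "\<forall>\<^sub>F x in nhds s. restr \<eta> (f x) = dcomp f (\<lambda>x. base (\<xi> (pt x 0))) x"
    if s: "s \<in> S" for s
  proof -
    have cont: "isCont f s" and fs: "f s = 0"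
      using f s by (auto simp: multigerm_def an_map_iff intro: analytic_map_isCont)
    have "\<forall>\<^sub>F X in nhds 0. \<forall>j. \<eta> (pt X 0) $ Inr j = 0"
      by (intro eventually_all_finite liftable_gsq_vanishing lg)
    then have zero: "\<forall>\<^sub>F x in nhds s. \<forall>j. \<eta> (pt (f x) 0) $ Inr j = 0"
      by (intro eventually_nhds_compose[OF cont]) (simp add: fs)
    have "\<forall>\<^sub>F z in nhds (pt s 0). \<eta> (F z) = dcomp F \<xi> z"
      using eq s by (simp add: agree_near_def near_iff_eventually)
    from eventually_nhds_compose[OF isCont_pt0 this] zero unfolding_along_base[OF unf s]
    show ?thesis
    proof eventually_elim
      case (elim x)
      then have "\<eta> (pt (f x) 0) = frechet_derivative F (at (pt x 0)) (\<xi> (pt x 0))"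
        by (simp add: dcomp_def)
      \<comment> \<open>dF preserves parameter components, so those of \<xi> at (x, 0) equal those
        of \<eta> at (f x, 0), which vanish.\<close>
      moreover have "\<xi> (pt x 0) = pt (base (\<xi> (pt x 0))) 0"
      proof (rule vec_sum_eqI)
        fix j
        have "\<xi> (pt x 0) $ Inr j = \<eta> (pt (f x) 0) $ Inr j"
          using elim(3) by (simp add: calculation)
        then show "\<xi> (pt x 0) $ Inr j = pt (base (\<xi> (pt x 0))) 0 $ Inr j"
          using elim(2) by simp
      qed simp
      ultimately show ?case
        using elim(3) by (metis restr_eq_base dcomp_def)
    qed
  qed
  ultimately show ?thesis
    unfolding liftable_def in_TRe_def agree_near_def near_iff_eventually o_def by blast
qed

text \<open>\<open>dcomp\<close> is pointwise \<open>'k\<close>-linear in the vector field, so the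
  function t comes out without being differentiated.\<close>

lemma dcomp_add_scale:
  fixes h :: "'k::real_normed_field ^ 'a::finite \<Rightarrow> 'k ^ 'b::finite"
  assumes "\<And>j. analytic_pt (\<lambda>y. h y $ j) x"
  shows "dcomp h (\<lambda>x. \<xi> x + t x *s \<zeta> x) x = dcomp h \<xi> x + t x *s dcomp h \<zeta> x"
  by (simp add: vec_eq_iff dcomp_def frechet_derivative_analytic_map[OF assms] sum_distrib_left
      distrib_left sum.distrib mult_ac)

lemma liftable_extension:
  fixes F :: "'k::real_normed_field ^ ('n::finite + unit) \<Rightarrow> 'k ^ ('p::finite + unit)"
  assumes f: "multigerm S f" and unf: "unfolding_of f S F" and st: "stable F ((\<lambda>s. pt s 0) ` S)"
    and l: "liftable f S \<eta>bar"
  shows "\<exists>\<eta>. liftable F ((\<lambda>s. pt s 0) ` S) \<eta> \<and> liftable (gsq ()) {0} \<eta> \<and> agree_near {0} \<eta>bar (restr \<eta>)"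
proof -
  define A where "A = (\<lambda>s. pt s (0 :: 'k ^ unit)) ` S"
  obtain \<xi>bar where \<eta>bar: "an_map {0} \<eta>bar" and \<xi>bar: "an_map S \<xi>bar"
    and eqbar: "agree_near S (\<eta>bar \<circ> f) (dcomp f \<xi>bar)"
    using l unfolding liftable_def in_TRe_def by blast
  have F: "an_map A F" and F0: "\<And>a. a \<in> A \<Longrightarrow> F a = 0"
    and par: "\<And>a. a \<in> A \<Longrightarrow> \<forall>\<^sub>F z in nhds a. \<forall>j. F z $ Inr j = z $ Inr j"
    using unf by (auto simp: unfolding_of_def multigerm_def near_iff_eventually A_def)
  define \<eta>0 where "\<eta>0 Z = pt (\<eta>bar (base Z)) (0 :: 'k ^ unit)" for Z :: "'k ^ ('p + unit)"
  define \<xi>0 where "\<xi>0 z = pt (\<xi>bar (base z)) (0 :: 'k ^ unit)" for z :: "'k ^ ('n + unit)"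
  have \<eta>0: "an_map {0} \<eta>0"
    unfolding an_map_iff
  proof (intro ballI allI)
    fix a :: "'k ^ ('p + unit)" and j :: "'p + unit" assume "a \<in> {0}"
    then show "analytic_pt (\<lambda>x. \<eta>0 x $ j) a"
      using \<eta>bar by (cases j) (auto simp: \<eta>0_def an_map_iff intro!: analytic_pt_extend)
  qed
  have \<xi>0: "an_map A \<xi>0"
    unfolding an_map_iff
  proof (intro ballI allI)
    fix a :: "'k ^ ('n + unit)" and j :: "'n + unit" assume "a \<in> A"
    then show "analytic_pt (\<lambda>x. \<xi>0 x $ j) a"
      using \<xi>bar by (cases j) (auto simp: \<xi>0_def an_map_iff A_def intro!: analytic_pt_extend)
  qed
  \<comment> \<open>The defect of \<xi>0 as a lift of \<eta>0, to be divided by the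
    parameter.\<close>
  define \<phi> where "\<phi> z = \<eta>0 (F z) - dcomp F \<xi>0 z" for z
  have \<phi>: "an_fun A (\<lambda>z. \<phi> z $ k)" for k
    unfolding an_fun_iff
  proof
    fix a assume a: "a \<in> A"
    have "analytic_pt (\<lambda>z. \<eta>0 (F z) $ k) a"
      by (rule analytic_pt_compose[where \<phi> = "\<lambda>Z. \<eta>0 Z $ k"])
        (use \<eta>0 F F0 a in \<open>auto simp: an_map_iff\<close>)
    moreover have "analytic_pt (\<lambda>z. dcomp F \<xi>0 z $ k) a"
      using an_map_dcomp[OF F \<xi>0] a by (simp add: an_map_iff)
    ultimately show "analytic_pt (\<lambda>z. \<phi> z $ k) a"
      by (simp add: \<phi>_def analytic_pt_diff)
  qed
  have van: "\<forall>\<^sub>F z in nhds a. z $ Inr () = 0 \<longrightarrow> \<phi> z = 0" if a: "a \<in> A" for a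
  proof -
    obtain s where s: "s \<in> S" "a = pt s 0" using a by (auto simp: A_def)
    have "\<forall>\<^sub>F x in nhds s. \<eta>bar (f x) = dcomp f \<xi>bar x"
      using eqbar s by (simp add: agree_near_def near_iff_eventually)
    \<comment> \<open>The claim about x near \<open>base a\<close> is pulled back along
      \<open>base\<close>: a point z with zero parameter equals
      \<open>pt (base z) 0\<close>.\<close>
    with unfolding_along_base[OF unf s(1)] have "\<forall>\<^sub>F x in nhds (base a). \<phi> (pt x 0) = 0"
      unfolding s(2) base_pt
    proof eventually_elim
      case (elim x)
      then have "dcomp F \<xi>0 (pt x 0) $ Inr () = 0" "base (dcomp F \<xi>0 (pt x 0)) = dcomp f \<xi>bar x"
        by (simp_all add: dcomp_def \<xi>0_def)
      then have "dcomp F \<xi>0 (pt x 0) = pt (dcomp f \<xi>bar x) 0"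
        using eq_pt_base by metis
      then show ?case using elim by (simp add: \<phi>_def \<eta>0_def)
    qed
    from eventually_nhds_compose[OF isCont_base this] show ?thesis
      by eventually_elim (metis eq_pt_base)
  qed
  have "\<exists>\<psi>. an_fun A \<psi> \<and> near A (\<lambda>z. \<phi> z $ k = z $ Inr () * \<psi> z)" for k
  proof (rule an_fun_divide_coord[OF \<phi>])
    show "a $ Inr () = 0" if "a \<in> A" for a using that by (auto simp: A_def)
    show "\<forall>\<^sub>F z in nhds a. z $ Inr () = 0 \<longrightarrow> \<phi> z $ k = 0" if "a \<in> A" for a
      using van[OF that] by eventually_elim simp
  qed
  then have "\<forall>k. \<exists>\<psi>. an_fun A \<psi> \<and> near A (\<lambda>z. \<phi> z $ k = z $ Inr () * \<psi> z)" ..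
  from choice[OF this] obtain \<psi> where \<psi>: "\<And>k. an_fun A (\<psi> k)"
    "\<And>k. near A (\<lambda>z. \<phi> z $ k = z $ Inr () * \<psi> k z)" by blast
  have "an_map A (\<lambda>z. \<chi> k. \<psi> k z)"
    using \<psi>(1) by (simp add: an_map_iff an_fun_iff)
  then obtain \<xi>1 \<eta>1 where \<xi>1: "an_map A \<xi>1" and \<eta>1: "an_map {0} \<eta>1"
    and eq1: "agree_near A (\<lambda>z. \<chi> k. \<psi> k z) (\<lambda>z. dcomp F \<xi>1 z + \<eta>1 (F z))"
    using st unfolding stable_def A_def by blast
  \<comment> \<open>In \<phi> = \<lambda> (dF \<xi>1 + \<eta>1 o F) the second summand moves to the
    target field, hence the minus sign, and the first to the lift.\<close>
  define \<eta> where "\<eta> Z = \<eta>0 Z - Z $ Inr () *s \<eta>1 Z" for Z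
  have \<eta>: "an_map {0} \<eta>"
    using \<eta>0 \<eta>1 unfolding \<eta>_def an_map_iff by (auto intro!: analytic_pt_diff analytic_pt_mult)
  have "liftable F A \<eta>"
    unfolding liftable_def in_TRe_def
  proof (intro conjI \<eta> exI)
    show "an_map A (\<lambda>z. \<xi>0 z + z $ Inr () *s \<xi>1 z)"
      using \<xi>0 \<xi>1 unfolding an_map_iff by (auto intro!: analytic_pt_add analytic_pt_mult)
    show "agree_near A (\<eta> \<circ> F) (dcomp F (\<lambda>z. \<xi>0 z + z $ Inr () *s \<xi>1 z))"
      unfolding agree_near_def near_iff_eventually
    proof
      fix a assume a: "a \<in> A"
      have "\<forall>\<^sub>F z in nhds a. \<forall>j. analytic_pt (\<lambda>y. F y $ j) z"
        using F a unfolding an_map_def near_iff_eventually by blast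
      moreover have "\<forall>\<^sub>F z in nhds a. \<forall>k. \<phi> z $ k = z $ Inr () * \<psi> k z"
        using \<psi>(2) a unfolding near_iff_eventually by (intro eventually_all_finite) blast
      moreover have "\<forall>\<^sub>F z in nhds a. (\<chi> k. \<psi> k z) = dcomp F \<xi>1 z + \<eta>1 (F z)"
        using eq1 a unfolding agree_near_def near_iff_eventually by blast
      ultimately show "\<forall>\<^sub>F z in nhds a. (\<eta> \<circ> F) z = dcomp F (\<lambda>z. \<xi>0 z + z $ Inr () *s \<xi>1 z) z"
        using par[OF a]
      proof eventually_elim
        case (elim z)
        have "\<phi> z = z $ Inr () *s (dcomp F \<xi>1 z + \<eta>1 (F z))"
          using elim(2) by (simp add: vec_eq_iff flip: elim(3))
        then have "\<eta>0 (F z) - z $ Inr () *s \<eta>1 (F z) = dcomp F \<xi>0 z + z $ Inr () *s dcomp F \<xi>1 z"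
          by (simp add: \<phi>_def vector_add_ldistrib algebra_simps)
        \<comment> \<open>F keeps the parameter, so the factor \<lambda> evaluated at F z is that at
          z.\<close>
        then show ?case
          using elim(1,4) by (simp add: \<eta>_def dcomp_add_scale)
      qed
    qed
  qed
  moreover have "liftable (gsq ()) {0} \<eta>"
    unfolding liftable_def in_TRe_def
  proof (intro conjI \<eta> exI)
    \<comment> \<open>Along \<open>gsq ()\<close> the last component of \<eta> is -\<lambda>^2
      \<eta>1 = 2 \<lambda> (-1/2 \<lambda> \<eta>1), and 2 \<lambda> is the factor that the
      differential supplies.\<close>
    define \<zeta> where "\<zeta> w = (\<chi> k. case k of Inl _ \<Rightarrow> \<eta> (gsq () w) $ k
      | Inr _ \<Rightarrow> - (1 / 2) * (w $ k * \<eta>1 (gsq () w) $ k))" for w :: "'k ^ ('p + unit)"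
    have g0: "gsq () (0 :: 'k ^ ('p + unit)) = 0" by (rule vec_sum_eqI) (simp_all add: gsq_def)
    have g: "analytic_pt (\<lambda>w. gsq () w $ k) a" for k and a :: "'k ^ ('p + unit)"
      by (cases k) (auto simp: gsq_def power2_eq_square intro: analytic_pt_mult)
    have comp: "analytic_pt (\<lambda>w. h (gsq () w) $ k) 0" if "an_map {0} h"
      for h :: "'k ^ ('p + unit) \<Rightarrow> 'k ^ ('p + unit)" and k
      by (rule analytic_pt_compose[where \<phi> = "\<lambda>Z. h Z $ k"])
        (use that g in \<open>auto simp: an_map_iff g0\<close>)
    have "analytic_pt (\<lambda>w. - (1 / 2) * (w $ Inr () * \<eta>1 (gsq () w) $ Inr ())) 0"
      by (intro analytic_pt_mult analytic_pt_const analytic_pt_coord comp \<eta>1)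
    then have "analytic_pt (\<lambda>w. \<zeta> w $ k) 0" for k
      by (cases k) (simp_all add: \<zeta>_def comp[OF \<eta>])
    then show "an_map {0} \<zeta>" by (simp add: an_map_iff)
    have "\<eta> (gsq () w) = dcomp (gsq ()) \<zeta> w" for w
      by (rule vec_sum_eqI)
        (simp_all add: dcomp_gsq \<zeta>_def \<eta>_def \<eta>0_def gsq_def power2_eq_square)
    then show "agree_near {0} (\<eta> \<circ> gsq ()) (dcomp (gsq ()) \<zeta>)"
      by (simp add: agree_near_def near_iff_eventually)
  qed
  moreover have "restr \<eta> X = \<eta>bar X" for X
    by (simp add: restr_eq_base \<eta>_def \<eta>0_def vec_eq_iff)
  then have "agree_near {0} \<eta>bar (restr \<eta>)"
    by (simp add: agree_near_def near_iff_eventually)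
  ultimately show ?thesis unfolding A_def by blast
qed

theorem theorem2:
  fixes f :: "'k::real_normed_field ^ 'n::finite \<Rightarrow> 'k ^ 'p::finite"
    and S :: "('k ^ 'n) set"
    and F :: "'k ^ ('n + 'r::finite) \<Rightarrow> 'k ^ ('p + 'r)"
  assumes mg: "multigerm S f"
    and fm: "finite_multiplicity f S"
    and cr: "corank_le_one f S"
  shows "(unfolding_of f S F \<and> stable F ((\<lambda>s. pt s 0) ` S) \<longrightarrow>
           (\<forall>\<eta>. liftable F ((\<lambda>s. pt s 0) ` S) \<eta> \<and> (\<forall>i. liftable (gsq i) {0} \<eta>)
                 \<longrightarrow> liftable f S (restr \<eta>)))
      \<and> (\<forall>F1 :: 'k ^ ('n + unit) \<Rightarrow> 'k ^ ('p + unit).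
           unfolding_of f S F1 \<and> stable F1 ((\<lambda>s. pt s 0) ` S) \<longrightarrow>
           (\<forall>\<eta>bar. liftable f S \<eta>bar \<longrightarrow>
              (\<exists>\<eta>. liftable F1 ((\<lambda>s. pt s 0) ` S) \<eta> \<and> liftable (gsq ()) {0} \<eta> \<and>
                   agree_near {0} \<eta>bar (restr \<eta>))))"
  using liftable_restr[OF mg] liftable_extension[OF mg] by blast

end
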